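(* Consider an $n$-joint rigid robot manipulator driven by DC motors, $$D(q)\ddot q+C(q,\dot q)\dot q+g(q)=u,\qquad u=k_t\, i,\qquad L\,\dot i+R\,i+k_b\dot q=v,$$ with $q,i,u,v\in\mathbb R^n$ and scalar constants $L,R,k_b,k_t>0$, where $D(q)$ is symmetric positive definite for all $q$, $\dot D(q)-2C(q,\dot q)$ is skew-symmetric for all $(q,\dot q)$, and $g$ is the gravitational force vector (gradient of the gravitational potential energy). Assume that $D,C,g$ are at least twice continuously differentiable, that the partial derivatives of their elements are over-bounded by nondecreasing functions of $|q|$ and $|\dot q|$, and that there exist positive constants $d_m,d_M,k_c,k_g$ such that for all $q,\dot q\in\mathbb R^n$ $$d_m\le|D(q)|\le d_M,\qquad |C(q,\dot q)|\le k_c|\dot q|,\qquad \left|\frac{\partial g(q)}{\partial q}\right|\le k_g.$$ Let $q^*\in\mathbb R^n$ be a constant set-point, $\tilde q:=q-q^*$, let $k_p,k_d,k_i>0$ be control gains and $R'>0$, and let $$u^*=-k_p\tilde q-k_d\dot q+\nu,\qquad \dot\nu=-k_i\tilde q,\qquad i^*=\frac{u^*}{k_t},\qquad \tilde i:=i-i^*,$$ $$v=-R'\tilde i+R\,i^*+k_b\dot q+L\,\frac{d i^*}{dt}.$$ Then the resulting closed-loop system, with state $(\tilde q,\dot q,\nu-g(q^* ),\tilde i)$, is uniformly semiglobally asymptotically stable (USAS) with respect to the tuning parameters $(k_p,k_d,k_i)\in(0,\infty)^3$.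
   Context: $|\cdot|$ is the Euclidean norm of vectors and the induced $L_2$ norm of matrices; $\mathcal B_\Delta$ is the closed ball of radius $\Delta$ centred at the origin. The integrator state $\nu$ is initialized at $\nu(0)=\hat g(q^* )$, where $\hat g(q^* )$ is a constant guess of the unknown vector $g(q^* )$. Class $\mathcal K_\infty$: continuous strictly increasing unbounded functions $\mathbb R_{\ge0}\to\mathbb R_{\ge0}$ vanishing at $0$. Class $\mathcal L$: continuous non-increasing functions $\mathbb R_{\ge0}\to\mathbb R_{\ge0}$ tending to zero at infinity. USAS. A parameterized system $\dot x=f(t,x,\theta)$ is USAS on a parameter set $\Theta$ if, for every $\Delta>0$, there exists $\theta^\star\in\Theta$ such that the origin is uniformly asymptotically stable on $\mathcal B_\Delta$ for $\dot x=f(t,x,\theta^\star)$, i.e. there exist $\eta\in\mathcal K_\infty$ and $\sigma\in\mathcal L$ such that for all $x_0\in\mathcal B_\Delta$ and all $t_0\ge0$ the solutions satisfy $|x(t,t_0,x_0)|\le\eta(|x_0|)$ and $|x(t,t_0,x_0)|\le\sigma(t-t_0)$ for all $t\ge t_0$. *)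

theory Defs
  imports "HOL-Analysis.Analysis"
begin

section \<open>Uniform semiglobal asymptotic stability\<close>

definition class_K_infty :: "(real \<Rightarrow> real) \<Rightarrow> bool" where
  "class_K_infty \<eta> \<longleftrightarrow>
     continuous_on {0..} \<eta> \<and> strict_mono_on {0..} \<eta> \<and> \<eta> 0 = 0 \<and> \<not> bdd_above (\<eta> ` {0..})"

definition class_L :: "(real \<Rightarrow> real) \<Rightarrow> bool" where
  "class_L \<sigma> \<longleftrightarrow>
     continuous_on {0..} \<sigma> \<and> antimono_on {0..} \<sigma> \<and> (\<forall>s\<ge>0. 0 \<le> \<sigma> s) \<and> (\<sigma> \<longlongrightarrow> 0) at_top"

definition ode_solution ::
  "(real \<Rightarrow> 'x \<Rightarrow> 'x) \<Rightarrow> real set \<Rightarrow> (real \<Rightarrow> 'x::real_normed_vector) \<Rightarrow> bool" where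
  "ode_solution f J x \<longleftrightarrow> (\<forall>t\<in>J. (x has_vector_derivative f t (x t)) (at t within J))"

text \<open>
  The bounds are required of every solution, including those given only on a bounded interval
  \<open>{t0..<T}\<close>, and a solution on all of \<open>{t0..}\<close> is required to exist; so finite escape times do
  not satisfy the definition vacuously.
\<close>

definition UAS_on :: "(real \<Rightarrow> 'x \<Rightarrow> 'x) \<Rightarrow> 'x::real_normed_vector set \<Rightarrow> bool" where
  "UAS_on f B \<longleftrightarrow>
     (\<exists>\<eta> \<sigma>. class_K_infty \<eta> \<and> class_L \<sigma> \<and>
       (\<forall>x0\<in>B. \<forall>t0\<ge>0.
          (\<exists>x. ode_solution f {t0..} x \<and> x t0 = x0) \<and>
          (\<forall>T>t0. \<forall>x. ode_solution f {t0..<T} x \<and> x t0 = x0 \<longrightarrow>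
             (\<forall>t\<in>{t0..<T}. norm (x t) \<le> \<eta> (norm x0) \<and> norm (x t) \<le> \<sigma> (t - t0)))))"

definition USAS :: "(real \<Rightarrow> 'x \<Rightarrow> 'p \<Rightarrow> 'x::real_normed_vector) \<Rightarrow> 'p set \<Rightarrow> bool" where
  "USAS f \<Theta> \<longleftrightarrow> (\<forall>\<Delta>>0. \<exists>\<theta>\<in>\<Theta>. UAS_on (\<lambda>t x. f t x \<theta>) (cball 0 \<Delta>))"


section \<open>Regularity and matrix notions\<close>

definition twice_cont_diff :: "('a::real_normed_vector \<Rightarrow> 'b::real_normed_vector) \<Rightarrow> bool" where
  "twice_cont_diff f \<longleftrightarrow>
     (\<exists>(f' :: 'a \<Rightarrow> 'a \<Rightarrow>\<^sub>L 'b) (f'' :: 'a \<Rightarrow> 'a \<Rightarrow>\<^sub>L ('a \<Rightarrow>\<^sub>L 'b)).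
        (\<forall>x. (f has_derivative blinfun_apply (f' x)) (at x)) \<and>
        (\<forall>x. (f' has_derivative blinfun_apply (f'' x)) (at x)) \<and>
        continuous_on UNIV f'')"

text \<open>The directions in \<open>Basis\<close> are the coordinate directions of \<open>q\<close> and of \<open>w\<close> (the velocity).\<close>

definition partials_overbounded :: "((real^'n) \<times> (real^'n) \<Rightarrow> real) \<Rightarrow> bool" where
  "partials_overbounded f \<longleftrightarrow>
     (\<forall>b\<in>Basis. \<exists>\<rho> :: real \<Rightarrow> real \<Rightarrow> real.
        (\<forall>r r' s s'. 0 \<le> r \<and> r \<le> r' \<and> 0 \<le> s \<and> s \<le> s' \<longrightarrow> \<rho> r s \<le> \<rho> r' s') \<and>
        (\<forall>q w. \<bar>frechet_derivative f (at (q, w)) b\<bar> \<le> \<rho> (norm q) (norm w)))"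

definition positive_definite :: "real^'n^'n \<Rightarrow> bool" where
  "positive_definite A \<longleftrightarrow> (\<forall>x. x \<noteq> 0 \<longrightarrow> 0 < x \<bullet> (A *v x))"

abbreviation matrix_norm :: "real^'n^'m \<Rightarrow> real" where
  "matrix_norm A \<equiv> onorm ((*v) A)"


section \<open>The closed loop\<close>

text \<open>
  The state is \<open>(e, w, z, j)\<close>, where \<open>e = q - qs\<close>, \<open>w\<close> is the joint velocity, \<open>z = \<nu> - g qs\<close> and
  \<open>j = i - istar\<close>; \<open>distar\<close> is the time derivative of \<open>istar\<close> along the motion.
  The system is autonomous, so the time argument is ignored.
\<close>

definition closed_loop ::
  "(real^'n \<Rightarrow> real^'n^'n) \<Rightarrow> (real^'n \<Rightarrow> real^'n \<Rightarrow> real^'n^'n) \<Rightarrow> (real^'n \<Rightarrow> real^'n) \<Rightarrow>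
   real \<Rightarrow> real \<Rightarrow> real \<Rightarrow> real \<Rightarrow> real \<Rightarrow> real^'n \<Rightarrow>
   real \<Rightarrow> (real^'n) \<times> (real^'n) \<times> (real^'n) \<times> (real^'n) \<Rightarrow> real \<times> real \<times> real \<Rightarrow>
   (real^'n) \<times> (real^'n) \<times> (real^'n) \<times> (real^'n)" where
  "closed_loop D C g L R kb kt R' qs t = (\<lambda>(e, w, z, j) (kp, kd, ki).
     let q = qs + e;
         \<nu> = g qs + z;
         ustar = - (kp *\<^sub>R e) - kd *\<^sub>R w + \<nu>;
         istar = (1 / kt) *\<^sub>R ustar;
         i = istar + j;
         u = kt *\<^sub>R i;
         acc = matrix_inv (D q) *v (u - C q w *v w - g q);
         d\<nu> = - (ki *\<^sub>R e);
         distar = (1 / kt) *\<^sub>R (- (kp *\<^sub>R w) - kd *\<^sub>R acc + d\<nu>);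
         v = - (R' *\<^sub>R j) + R *\<^sub>R istar + kb *\<^sub>R w + L *\<^sub>R distar;
         di = (1 / L) *\<^sub>R (v - R *\<^sub>R i - kb *\<^sub>R w)
     in (w, acc, d\<nu>, di - distar))"

text \<open>
  The same closed loop as differential equations for the physical signals. Lemma
  \<open>ode_solution_closed_loop_iff\<close> below shows that the two descriptions agree.
\<close>

definition physical_closed_loop ::
  "(real^'n \<Rightarrow> real^'n^'n) \<Rightarrow> (real^'n \<Rightarrow> real^'n \<Rightarrow> real^'n^'n) \<Rightarrow> (real^'n \<Rightarrow> real^'n) \<Rightarrow>
   real \<Rightarrow> real \<Rightarrow> real \<Rightarrow> real \<Rightarrow> real \<Rightarrow> real^'n \<Rightarrow> real \<times> real \<times> real \<Rightarrow> real set \<Rightarrow>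
   (real \<Rightarrow> real^'n) \<Rightarrow> (real \<Rightarrow> real^'n) \<Rightarrow> (real \<Rightarrow> real^'n) \<Rightarrow> (real \<Rightarrow> real^'n) \<Rightarrow>
   (real \<Rightarrow> real^'n) \<Rightarrow> bool" where
  "physical_closed_loop D C g L R kb kt R' qs = (\<lambda>(kp, kd, ki) J q dq \<nu> i istar.
     (\<forall>t. istar t = (1 / kt) *\<^sub>R (- (kp *\<^sub>R (q t - qs)) - kd *\<^sub>R dq t + \<nu> t)) \<and>
     (\<forall>t\<in>J. \<exists>ddq di distar u v.
        (q has_vector_derivative dq t) (at t within J) \<and>
        (dq has_vector_derivative ddq) (at t within J) \<and>
        (\<nu> has_vector_derivative - (ki *\<^sub>R (q t - qs))) (at t within J) \<and>
        (i has_vector_derivative di) (at t within J) \<and>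
        (istar has_vector_derivative distar) (at t within J) \<and>
        D (q t) *v ddq + C (q t) (dq t) *v dq t + g (q t) = u \<and>
        u = kt *\<^sub>R i t \<and>
        L *\<^sub>R di + R *\<^sub>R i t + kb *\<^sub>R dq t = v \<and>
        v = - (R' *\<^sub>R (i t - istar t)) + R *\<^sub>R istar t + kb *\<^sub>R dq t + L *\<^sub>R distar))"

lemma positive_definite_inverse:
  fixes A :: "real^'n^'n"
  assumes "positive_definite A"
  shows "matrix_inv A ** A = mat 1" "A ** matrix_inv A = mat 1"
proof -
  have "\<forall>x. A *v x = 0 \<longrightarrow> x = 0"
    using assms unfolding positive_definite_def by (metis inner_zero_right less_irrefl)
  then have "invertible A"
    unfolding invertible_left_inverse matrix_left_invertible_ker .
  then show "matrix_inv A ** A = mat 1" "A ** matrix_inv A = mat 1"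
    unfolding invertible_def matrix_inv_def by (metis (mono_tags, lifting) someI_ex)+
qed

lemma has_vector_derivative_prod_iff:
  "((\<lambda>t. (a t, b t)) has_vector_derivative (a', b')) (at x within S) \<longleftrightarrow>
     (a has_vector_derivative a') (at x within S) \<and> (b has_vector_derivative b') (at x within S)"
proof
  assume *: "((\<lambda>t. (a t, b t)) has_vector_derivative (a', b')) (at x within S)"
  show "(a has_vector_derivative a') (at x within S) \<and> (b has_vector_derivative b') (at x within S)"
    using bounded_linear.has_vector_derivative[OF bounded_linear_fst *]
      bounded_linear.has_vector_derivative[OF bounded_linear_snd *] by simp
qed (simp add: has_vector_derivative_Pair)

lemma ode_solution_closed_loop_iff:
  fixes qs :: "real^'n"
  assumes "\<And>q. positive_definite (D q)" and "L > 0" and "kt > 0"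
    and istar: "\<And>t. istar t = (1 / kt) *\<^sub>R (- (kp *\<^sub>R (q t - qs)) - kd *\<^sub>R dq t + \<nu> t)"
  shows "ode_solution (\<lambda>t x. closed_loop D C g L R kb kt R' qs t x (kp, kd, ki)) J
           (\<lambda>t. (q t - qs, dq t, \<nu> t - g qs, i t - istar t)) \<longleftrightarrow>
         physical_closed_loop D C g L R kb kt R' qs (kp, kd, ki) J q dq \<nu> i istar"
  (is "?ode \<longleftrightarrow> ?phys")
proof -
  define acc where "acc t = matrix_inv (D (q t)) *v (kt *\<^sub>R i t - C (q t) (dq t) *v dq t - g (q t))" for t
  define ds where "ds t = (1 / kt) *\<^sub>R (- (kp *\<^sub>R dq t) - kd *\<^sub>R acc t - ki *\<^sub>R (q t - qs))" for t
  have field: "closed_loop D C g L R kb kt R' qs t (q t - qs, dq t, \<nu> t - g qs, i t - istar t) (kp, kd, ki)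
      = (dq t, acc t, - (ki *\<^sub>R (q t - qs)), (1 / L) *\<^sub>R
          (- (R' *\<^sub>R (i t - istar t)) + R *\<^sub>R istar t + kb *\<^sub>R dq t + L *\<^sub>R ds t - R *\<^sub>R i t - kb *\<^sub>R dq t)
          - ds t)" for t
  proof -
    have eqs: "qs + (q t - qs) = q t" "g qs + (\<nu> t - g qs) = \<nu> t" "istar t + (i t - istar t) = i t"
      by simp_all
    show ?thesis
      unfolding closed_loop_def Let_def prod.case eqs istar[symmetric] acc_def ds_def
      by simp
  qed
  have cancel: "(1 / L) *\<^sub>R (y + L *\<^sub>R d - a - b) - d = (1 / L) *\<^sub>R (y - a - b)" for y d a b :: "real^'n"
    using \<open>L > 0\<close> by (simp add: algebra_simps)
  define dj where "dj t = (1 / L) *\<^sub>R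
    (- (R' *\<^sub>R (i t - istar t)) + R *\<^sub>R istar t + kb *\<^sub>R dq t - R *\<^sub>R i t - kb *\<^sub>R dq t)" for t
  have field': "closed_loop D C g L R kb kt R' qs t (q t - qs, dq t, \<nu> t - g qs, i t - istar t) (kp, kd, ki)
      = (dq t, acc t, - (ki *\<^sub>R (q t - qs)), dj t)" for t
    unfolding field cancel dj_def ..
  have acc_iff: "D (q t) *v a + C (q t) (dq t) *v dq t + g (q t) = kt *\<^sub>R i t \<longleftrightarrow> a = acc t" for t a
  proof -
    have "D (q t) *v a + C (q t) (dq t) *v dq t + g (q t) = kt *\<^sub>R i t \<longleftrightarrow>
        D (q t) *v a = kt *\<^sub>R i t - C (q t) (dq t) *v dq t - g (q t)"
      by (auto simp: algebra_simps)
    also have "\<dots> \<longleftrightarrow> a = acc t"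
      unfolding acc_def
      using positive_definite_inverse[OF assms(1)[of "q t"]]
      by (metis matrix_vector_mul_assoc matrix_vector_mul_lid)
    finally show ?thesis .
  qed
  have dj_iff: "L *\<^sub>R di + R *\<^sub>R i t + kb *\<^sub>R dq t =
      - (R' *\<^sub>R (i t - istar t)) + R *\<^sub>R istar t + kb *\<^sub>R dq t + L *\<^sub>R d \<longleftrightarrow> di - d = dj t" for t di d
  proof -
    have "di - d = dj t \<longleftrightarrow> L *\<^sub>R (di - d) = L *\<^sub>R dj t"
      using \<open>L > 0\<close> by simp
    also have "L *\<^sub>R dj t = - (R' *\<^sub>R (i t - istar t)) + R *\<^sub>R istar t + kb *\<^sub>R dq t - R *\<^sub>R i t - kb *\<^sub>R dq t"
      using \<open>L > 0\<close> unfolding dj_def by simp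
    finally show ?thesis
      by (auto simp: algebra_simps)
  qed
  have ode: "?ode \<longleftrightarrow> (\<forall>t\<in>J.
      (q has_vector_derivative dq t) (at t within J) \<and>
      (dq has_vector_derivative acc t) (at t within J) \<and>
      (\<nu> has_vector_derivative - (ki *\<^sub>R (q t - qs))) (at t within J) \<and>
      ((\<lambda>t. i t - istar t) has_vector_derivative dj t) (at t within J))"
    unfolding ode_solution_def field' has_vector_derivative_prod_iff
      has_vector_derivative_diff_const ..
  have istar_deriv: "(istar has_vector_derivative ds t) (at t within J)"
    if "(q has_vector_derivative dq t) (at t within J)"
      "(dq has_vector_derivative acc t) (at t within J)"
      "(\<nu> has_vector_derivative - (ki *\<^sub>R (q t - qs))) (at t within J)" for t
  proof -
    have "((\<lambda>t. (1 / kt) *\<^sub>R (- (kp *\<^sub>R (q t - qs)) - kd *\<^sub>R dq t + \<nu> t)) has_vector_derivative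
       (1 / kt) *\<^sub>R (- (kp *\<^sub>R (dq t - 0)) - kd *\<^sub>R acc t + - (ki *\<^sub>R (q t - qs)))) (at t within J)"
      by (intro bounded_linear.has_vector_derivative[OF bounded_linear_scaleR_right]
          has_vector_derivative_add has_vector_derivative_diff has_vector_derivative_minus
          has_vector_derivative_const that)
    moreover have "istar = (\<lambda>t. (1 / kt) *\<^sub>R (- (kp *\<^sub>R (q t - qs)) - kd *\<^sub>R dq t + \<nu> t))"
      using istar by blast
    ultimately show ?thesis
      by (simp add: ds_def)
  qed
  show ?thesis
  proof
    assume ?ode
    then have *: "(q has_vector_derivative dq t) (at t within J)"
      "(dq has_vector_derivative acc t) (at t within J)"
      "(\<nu> has_vector_derivative - (ki *\<^sub>R (q t - qs))) (at t within J)"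
      "((\<lambda>t. i t - istar t) has_vector_derivative dj t) (at t within J)" if "t \<in> J" for t
      using that unfolding ode by blast+
    have i_deriv: "(i has_vector_derivative dj t + ds t) (at t within J)" if "t \<in> J" for t
      using has_vector_derivative_add[OF *(4)[OF that] istar_deriv[OF *(1-3)[OF that]]] by simp
    then show ?phys
      unfolding physical_closed_loop_def prod.case
    proof (intro conjI allI ballI)
      fix t assume "t \<in> J"
      have "D (q t) *v acc t + C (q t) (dq t) *v dq t + g (q t) = kt *\<^sub>R i t"
        by (simp only: acc_iff)
      moreover have "L *\<^sub>R (dj t + ds t) + R *\<^sub>R i t + kb *\<^sub>R dq t =
          - (R' *\<^sub>R (i t - istar t)) + R *\<^sub>R istar t + kb *\<^sub>R dq t + L *\<^sub>R ds t"
        by (simp only: dj_iff add_diff_cancel_right')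
      ultimately show "\<exists>ddq di distar u v.
        (q has_vector_derivative dq t) (at t within J) \<and>
        (dq has_vector_derivative ddq) (at t within J) \<and>
        (\<nu> has_vector_derivative - (ki *\<^sub>R (q t - qs))) (at t within J) \<and>
        (i has_vector_derivative di) (at t within J) \<and>
        (istar has_vector_derivative distar) (at t within J) \<and>
        D (q t) *v ddq + C (q t) (dq t) *v dq t + g (q t) = u \<and>
        u = kt *\<^sub>R i t \<and>
        L *\<^sub>R di + R *\<^sub>R i t + kb *\<^sub>R dq t = v \<and>
        v = - (R' *\<^sub>R (i t - istar t)) + R *\<^sub>R istar t + kb *\<^sub>R dq t + L *\<^sub>R distar"
        using *[OF \<open>t \<in> J\<close>] i_deriv[OF \<open>t \<in> J\<close>] istar_deriv[OF *(1-3)[OF \<open>t \<in> J\<close>]]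
        by blast
    qed (rule istar)
  next
    assume ph: ?phys
    show ?ode
      unfolding ode
    proof
      fix t assume "t \<in> J"
      then obtain ddq di d u v where *: "(q has_vector_derivative dq t) (at t within J)"
        "(dq has_vector_derivative ddq) (at t within J)"
        "(\<nu> has_vector_derivative - (ki *\<^sub>R (q t - qs))) (at t within J)"
        "(i has_vector_derivative di) (at t within J)"
        "(istar has_vector_derivative d) (at t within J)"
        and u: "D (q t) *v ddq + C (q t) (dq t) *v dq t + g (q t) = u" "u = kt *\<^sub>R i t"
        and v: "L *\<^sub>R di + R *\<^sub>R i t + kb *\<^sub>R dq t = v"
          "v = - (R' *\<^sub>R (i t - istar t)) + R *\<^sub>R istar t + kb *\<^sub>R dq t + L *\<^sub>R d"
        using ph unfolding physical_closed_loop_def prod.case by blast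
      have "ddq = acc t"
        using u acc_iff by blast
      moreover have "di - d = dj t"
        using v dj_iff by blast
      ultimately show "(q has_vector_derivative dq t) (at t within J) \<and>
          (dq has_vector_derivative acc t) (at t within J) \<and>
          (\<nu> has_vector_derivative - (ki *\<^sub>R (q t - qs))) (at t within J) \<and>
          ((\<lambda>t. i t - istar t) has_vector_derivative dj t) (at t within J)"
        using * has_vector_derivative_diff[OF *(4) *(5)] by simp
    qed
  qed
qed

end

theory Submission
  imports Defs
begin

text \<open>
  The electrical loop decouples: the current error satisfies \<open>j' = - ((R + R') / L) j\<close>, so the motion
  is that of a PID-controlled manipulator perturbed by the exponentially decaying force \<open>kt j\<close>.
  Take \<open>kp = kd = K\<close> and \<open>ki = 1\<close>. To the energy of the closed loop one adds the cross terms
  \<open>e \<bullet> D w\<close>, which makes the derivative negative in \<open>e\<close>, and \<open>- z \<bullet> D w / (16 K)\<close>, which makes it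
  negative in \<open>z\<close>, together with a multiple of \<open>norm j ^ 2\<close> that absorbs the perturbation. For \<open>K\<close> above
  an affine function of \<open>\<Delta>\<close> the resulting \<open>V\<close> decays exponentially as long as \<open>norm e \<le> 2 \<Delta>\<close> and
  \<open>norm z \<le> 4 K \<Delta>\<close>. On \<open>cball 0 \<Delta>\<close> one has \<open>V \<le> 3 K \<Delta>^2 / 2\<close>, while \<open>V \<ge> K (norm e)^2 / 2\<close>, so
  solutions never leave this region. The ratio of the two bounds does not grow with \<open>K\<close>, hence the
  gain can be chosen before the region.
\<close>

section \<open>Differential equations\<close>

text \<open>The integrand may grow like the weight behind the norm in
  \<open>lipschitz_global_solution\<close>; integrating that weight gains a factor
  \<open>1 / \<omega>\<close>, the source of the contraction there. The lower endpoint contributes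
  \<open>- N / \<omega>\<close>, which is dropped since \<open>0 \<le> N\<close>.\<close>

lemma norm_integral_exp_bound:
  fixes f :: "real \<Rightarrow> 'a::banach"
  assumes "a \<le> b" "0 < \<omega>" "continuous_on {a..b} f"
    and bound: "\<And>s. s \<in> {a..b} \<Longrightarrow> norm (f s) \<le> N * exp (\<omega> * (s - a))"
  shows "norm (integral {a..b} f) \<le> N * exp (\<omega> * (b - a)) / \<omega>"
proof -
  have "((\<lambda>s. N * exp (\<omega> * (s - a))) has_integral
      N * exp (\<omega> * (b - a)) / \<omega> - N * exp (\<omega> * (a - a)) / \<omega>) {a..b}"
    using \<open>a \<le> b\<close> \<open>0 < \<omega>\<close>
    by (intro fundamental_theorem_of_calculus)
      (auto intro!: derivative_eq_intros simp flip: has_real_derivative_iff_has_vector_derivative)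
  then have int: "((\<lambda>s. N * exp (\<omega> * (s - a))) has_integral N * exp (\<omega> * (b - a)) / \<omega> - N / \<omega>) {a..b}"
    by simp
  have "0 \<le> N"
    using order_trans[OF norm_ge_zero bound[of a]] \<open>a \<le> b\<close> by simp
  have "norm (integral {a..b} f) \<le> integral {a..b} (\<lambda>s. N * exp (\<omega> * (s - a)))"
    using assms int
    by (intro integral_norm_bound_integral integrable_continuous_real[of a b f] has_integral_integrable[OF int]) auto
  also have "\<dots> = N * exp (\<omega> * (b - a)) / \<omega> - N / \<omega>"
    using int by (rule integral_unique)
  finally show ?thesis
    using \<open>0 \<le> N\<close> \<open>0 < \<omega>\<close> by (smt (verit) divide_nonneg_pos)
qed

text \<open>
  In the norm weighted by \<open>exp (- 2 * L * (t - t0))\<close> the Picard operator is a contraction with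
  factor \<open>1 / 2\<close> on the whole half-line, so no continuation argument is needed.
\<close>

lemma lipschitz_global_solution:
  fixes F :: "'a::banach \<Rightarrow> 'a"
  assumes lip: "L-lipschitz_on UNIV F" and "0 < L"
  shows "\<exists>x. ode_solution (\<lambda>t. F) {t0..} x \<and> x t0 = x0"
proof -
  define \<omega> where "\<omega> = 2 * L"
  have "0 < \<omega>" using \<open>0 < L\<close> by (simp add: \<omega>_def)
  \<comment> \<open>The unknown \<open>u\<close> is the solution divided by the growing weight, so
    it can be sought among bounded functions; the argument of \<open>F\<close> is the solution
    itself.\<close>
  define \<psi> where "\<psi> u s = F (exp (\<omega> * (s - t0)) *\<^sub>R apply_bcontfun u s)" for u :: "real \<Rightarrow>\<^sub>C 'a" and s
  \<comment> \<open>\<open>max t0 t\<close> continues the image constantly to the left of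
    \<open>t0\<close>, because bounded continuous functions are taken on the whole line.\<close>
  define G where "G u t = exp (- (\<omega> * (max t0 t - t0))) *\<^sub>R (x0 + integral {t0..max t0 t} (\<psi> u))"
    for u and t
  have contF: "continuous_on S F" for S
    using lipschitz_on_continuous_on[OF lip] continuous_on_subset by blast
  have cont\<psi>: "continuous_on S (\<psi> u)" for S u
    unfolding \<psi>_def
    by (intro continuous_on_compose2[OF contF[of UNIV]] continuous_intros) auto
  have contI: "continuous_on {t0..} (\<lambda>t. integral {t0..t} (\<psi> u))" for u
  proof -
    have "continuous (at t within {t0..}) (\<lambda>t. integral {t0..t} (\<psi> u))" if "t0 \<le> t" for t
    proof -
      have "continuous_on {t0..t + 1} (\<lambda>t. integral {t0..t} (\<psi> u))"
        by (intro indefinite_integral_continuous_1 integrable_continuous_real cont\<psi>)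
      then have "continuous (at t within {t0..t + 1}) (\<lambda>t. integral {t0..t} (\<psi> u))"
        using that by (simp add: continuous_on_eq_continuous_within)
      moreover have "at t within {t0..t + 1} = at t within {t0..}"
        by (rule at_within_nhd[where S = "{..<t + 1}"]) auto
      ultimately show ?thesis by simp
    qed
    then show ?thesis
      by (simp add: continuous_on_eq_continuous_within)
  qed
  have contG: "continuous_on UNIV (G u)" for u
    unfolding G_def
    by (intro continuous_intros continuous_on_compose2[OF contI]) auto
  \<comment> \<open>\<open>F\<close> grows at most linearly, so for bounded \<open>u\<close> the
    integrand is of the order of the weight; the inverse weight in front of the integral leaves a
    bound independent of \<open>t\<close>.\<close>
  have boundG: "norm (G u t) \<le> norm x0 + (norm (F 0) + L * C) / \<omega>"
    if C: "\<And>s. norm (apply_bcontfun u s) \<le> C" for u C t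
  proof -
    let ?\<tau> = "max t0 t"
    have "norm (\<psi> u s) \<le> (norm (F 0) + L * C) * exp (\<omega> * (s - t0))" if "t0 \<le> s" for s
    proof -
      let ?E = "exp (\<omega> * (s - t0))"
      have "1 \<le> ?E" using that \<open>0 < \<omega>\<close> by simp
      have "norm (\<psi> u s) \<le> norm (F 0) + norm (\<psi> u s - F 0)"
        by (metis add.commute diff_add_cancel norm_triangle_ineq)
      also have "norm (\<psi> u s - F 0) \<le> L * norm (?E *\<^sub>R apply_bcontfun u s - 0)"
        unfolding \<psi>_def by (rule lipschitz_on_normD[OF lip]) auto
      also have "\<dots> = L * (?E * norm (apply_bcontfun u s))"
        by simp
      also have "\<dots> \<le> L * (?E * C)"
        using C[of s] \<open>0 < L\<close> by (intro mult_left_mono) auto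
      also have "norm (F 0) \<le> norm (F 0) * ?E"
        using \<open>1 \<le> ?E\<close> by (simp add: mult_le_cancel_left1)
      finally show ?thesis by (simp add: algebra_simps)
    qed
    then have "norm (integral {t0..?\<tau>} (\<psi> u)) \<le> (norm (F 0) + L * C) * exp (\<omega> * (?\<tau> - t0)) / \<omega>"
      using \<open>0 < \<omega>\<close> cont\<psi> by (intro norm_integral_exp_bound) auto
    moreover define p where "p = exp (\<omega> * (?\<tau> - t0))"
    ultimately have le: "norm (integral {t0..?\<tau>} (\<psi> u)) \<le> (norm (F 0) + L * C) * p / \<omega>"
      by simp
    have "1 \<le> p" using \<open>0 < \<omega>\<close> by (simp add: p_def)
    have "norm (G u t) = inverse p * norm (x0 + integral {t0..?\<tau>} (\<psi> u))"
      by (simp add: G_def p_def exp_minus)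
    also have "\<dots> \<le> inverse p * (norm x0 + (norm (F 0) + L * C) * p / \<omega>)"
      using le \<open>1 \<le> p\<close> by (intro mult_left_mono norm_triangle_le) auto
    also have "\<dots> = inverse p * norm x0 + (norm (F 0) + L * C) / \<omega>"
      using \<open>1 \<le> p\<close> by (simp add: distrib_left)
    also have "\<dots> \<le> 1 * norm x0 + (norm (F 0) + L * C) / \<omega>"
      using \<open>1 \<le> p\<close> by (intro add_right_mono mult_right_mono) (auto simp: inverse_le_1_iff)
    finally show ?thesis by simp
  qed
  have "G u \<in> bcontfun" for u
  proof -
    obtain C where "\<And>s. norm (apply_bcontfun u s) \<le> C"
      using bounded_apply_bcontfun[of u] by (auto simp: bounded_iff)
    then have "norm (G u t) \<le> norm x0 + (norm (F 0) + L * C) / \<omega>" for t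
      by (rule boundG)
    then show ?thesis
      using contG unfolding bcontfun_def bounded_iff by blast
  qed
  then have app: "apply_bcontfun (Bcontfun (G u)) = G u" for u
    by (simp add: Bcontfun_inverse)
  have "dist (Bcontfun (G u)) (Bcontfun (G v)) \<le> 1 / 2 * dist u v" for u v
  proof (rule dist_bound)
    fix t
    let ?\<tau> = "max t0 t"
    have "norm (\<psi> u s - \<psi> v s) \<le> (L * dist u v) * exp (\<omega> * (s - t0))" for s
    proof -
      have "norm (\<psi> u s - \<psi> v s) \<le>
          L * norm (exp (\<omega> * (s - t0)) *\<^sub>R apply_bcontfun u s - exp (\<omega> * (s - t0)) *\<^sub>R apply_bcontfun v s)"
        unfolding \<psi>_def by (rule lipschitz_on_normD[OF lip]) auto
      also have "\<dots> = L * (exp (\<omega> * (s - t0)) * dist (apply_bcontfun u s) (apply_bcontfun v s))"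
        by (simp add: dist_norm flip: scaleR_diff_right)
      also have "\<dots> \<le> L * (exp (\<omega> * (s - t0)) * dist u v)"
        using \<open>0 < L\<close> dist_bounded by (intro mult_left_mono) auto
      finally show ?thesis by (simp add: algebra_simps)
    qed
    then have "norm (integral {t0..?\<tau>} (\<lambda>s. \<psi> u s - \<psi> v s)) \<le> (L * dist u v) * exp (\<omega> * (?\<tau> - t0)) / \<omega>"
      using \<open>0 < \<omega>\<close> cont\<psi> by (intro norm_integral_exp_bound continuous_intros) auto
    moreover have "G u t - G v t = exp (- (\<omega> * (?\<tau> - t0))) *\<^sub>R integral {t0..?\<tau>} (\<lambda>s. \<psi> u s - \<psi> v s)"
      unfolding G_def
      by (simp add: integral_diff integrable_continuous_real cont\<psi> flip: scaleR_diff_right)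
    moreover define p where "p = exp (\<omega> * (?\<tau> - t0))"
    ultimately have "norm (integral {t0..?\<tau>} (\<lambda>s. \<psi> u s - \<psi> v s)) \<le> (L * dist u v) * p / \<omega>"
      and diff: "G u t - G v t = inverse p *\<^sub>R integral {t0..?\<tau>} (\<lambda>s. \<psi> u s - \<psi> v s)"
      by (simp_all add: exp_minus)
    moreover have "0 < p" by (simp add: p_def)
    ultimately have "dist (G u t) (G v t) \<le> inverse p * ((L * dist u v) * p / \<omega>)"
      unfolding dist_norm[of "G u t"] diff norm_scaleR
      by (intro mult_mono) auto
    also have "\<dots> = 1 / 2 * dist u v"
      using \<open>0 < L\<close> by (simp add: p_def \<omega>_def)
    finally show "dist (apply_bcontfun (Bcontfun (G u)) t) (apply_bcontfun (Bcontfun (G v)) t)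
        \<le> 1 / 2 * dist u v"
      by (simp add: app)
  qed
  then have "\<exists>!u. Bcontfun (G u) = u"
    by (intro banach_fix_type[of "1 / 2"]) auto
  then obtain u where "Bcontfun (G u) = u" by blast
  then have fix_u: "apply_bcontfun u = G u" using app by metis
  define x where "x t = exp (\<omega> * (t - t0)) *\<^sub>R apply_bcontfun u t" for t
  have \<psi>_x: "\<psi> u = (\<lambda>s. F (x s))"
    by (simp add: \<psi>_def x_def fun_eq_iff)
  have x: "x t = x0 + integral {t0..t} (\<lambda>s. F (x s))" if "t0 \<le> t" for t
  proof -
    have "x t = exp (\<omega> * (t - t0)) *\<^sub>R G u t"
      by (simp add: x_def fix_u)
    also have "\<dots> = x0 + integral {t0..t} (\<psi> u)"
      using that by (simp add: G_def exp_minus max_absorb2)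
    finally show ?thesis by (simp add: \<psi>_x)
  qed
  have "(x has_vector_derivative F (x t)) (at t within {t0..})" if "t0 \<le> t" for t
  proof -
    have "continuous_on {t0..t + 1} (\<lambda>s. F (x s))"
      using cont\<psi>[of _ u] by (simp add: \<psi>_x)
    then have "((\<lambda>r. integral {t0..r} (\<lambda>s. F (x s))) has_vector_derivative F (x t)) (at t within {t0..t + 1})"
      using that by (intro integral_has_vector_derivative) auto
    then have "((\<lambda>r. x0 + integral {t0..r} (\<lambda>s. F (x s))) has_vector_derivative F (x t)) (at t within {t0..t + 1})"
      by (auto intro!: derivative_eq_intros)
    then have "(x has_vector_derivative F (x t)) (at t within {t0..t + 1})"
      by (rule has_vector_derivative_transform[rotated 2]) (use that x in auto)
    moreover have "at t within {t0..t + 1} = at t within {t0..}"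
      by (rule at_within_nhd[where S = "{..<t + 1}"]) auto
    ultimately show ?thesis by simp
  qed
  moreover have "x t0 = x0" using x[of t0] by simp
  ultimately show ?thesis by (auto simp: ode_solution_def)
qed

section \<open>Lyapunov decay, trapping and asymptotic stability\<close>

text \<open>Integrating factor: \<open>exp (\<mu> * (t - a)) * v t\<close> has a nonpositive
  derivative.\<close>

lemma exp_decay_of_deriv_le:
  fixes v v' :: "real \<Rightarrow> real"
  assumes "a \<le> b"
    and der: "\<And>t. t \<in> {a..b} \<Longrightarrow> (v has_real_derivative v' t) (at t within {a..b})"
    and le: "\<And>t. t \<in> {a..b} \<Longrightarrow> v' t \<le> - \<mu> * v t"
  shows "v b \<le> v a * exp (- \<mu> * (b - a))"
proof -
  define h where "h t = exp (\<mu> * (t - a)) * v t" for t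
  have h': "(h has_real_derivative exp (\<mu> * (t - a)) * (v' t + \<mu> * v t)) (at t within {a..b})"
    if "t \<in> {a..b}" for t
    unfolding h_def by (auto intro!: derivative_eq_intros der that simp: algebra_simps)
  have "h b \<le> h a"
  proof (rule DERIV_nonpos_imp_decreasing_open[OF \<open>a \<le> b\<close>])
    fix t assume t: "a < t" "t < b"
    have "exp (\<mu> * (t - a)) * (v' t + \<mu> * v t) \<le> 0"
      using le[of t] t by (simp add: mult_le_0_iff)
    moreover have "at t within {a..b} = at t"
      using t by (rule at_within_Icc_at)
    ultimately show "\<exists>y. DERIV h t :> y \<and> y \<le> 0"
      using h'[of t] t by force
  qed (rule DERIV_continuous_on[OF h'])
  then have "exp (\<mu> * (b - a)) * v b \<le> v a"
    by (simp add: h_def)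
  then have "v b \<le> v a / exp (\<mu> * (b - a))"
    by (simp add: pos_le_divide_eq mult.commute)
  then show ?thesis
    by (simp add: exp_minus divide_inverse)
qed

text \<open>A first-exit argument. Until the path first leaves \<open>interior S\<close> it lies in
  \<open>S\<close>, so \<open>V\<close> has not increased; then \<open>trap\<close> puts the exit
  point back into the interior, a contradiction.\<close>

lemma lyapunov_trapping:
  fixes x :: "real \<Rightarrow> 'a::topological_space" and V :: "'a \<Rightarrow> real"
  assumes cont: "continuous_on {t0..<T} x"
    and der: "\<And>t. t \<in> {t0..<T} \<Longrightarrow> ((\<lambda>t. V (x t)) has_real_derivative V' t) (at t within {t0..<T})"
    and decay: "\<And>t. t \<in> {t0..<T} \<Longrightarrow> x t \<in> S \<Longrightarrow> V' t \<le> - \<mu> * V (x t)"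
    and "closed S" and V_nonneg: "\<And>y. y \<in> S \<Longrightarrow> 0 \<le> V y"
    and trap: "\<And>y. y \<in> S \<Longrightarrow> V y \<le> V (x t0) \<Longrightarrow> y \<in> interior S"
    and "0 \<le> \<mu>" and x0: "x t0 \<in> S" and t: "t \<in> {t0..<T}"
  shows "x t \<in> S \<and> V (x t) \<le> V (x t0) * exp (- \<mu> * (t - t0))"
proof -
  have V_le: "V (x b) \<le> V (x t0) * exp (- \<mu> * (b - t0))"
    if "b \<in> {t0..<T}" "\<And>s. s \<in> {t0..b} \<Longrightarrow> x s \<in> S" for b
  proof (rule exp_decay_of_deriv_le)
    fix s assume "s \<in> {t0..b}"
    then show "((\<lambda>t. V (x t)) has_real_derivative V' s) (at s within {t0..b})"
      using that by (auto intro: DERIV_subset[OF der])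
    show "V' s \<le> - \<mu> * V (x s)"
      using that \<open>s \<in> {t0..b}\<close> by (intro decay) auto
  qed (use that in auto)
  have V_le0: "V (x b) \<le> V (x t0)"
    if "b \<in> {t0..<T}" "\<And>s. s \<in> {t0..b} \<Longrightarrow> x s \<in> S" for b
  proof -
    have "V (x t0) * exp (- \<mu> * (b - t0)) \<le> V (x t0) * 1"
      using that \<open>0 \<le> \<mu>\<close> V_nonneg[OF x0] by (intro mult_left_mono) (auto simp: mult_nonneg_nonneg)
    then show ?thesis using V_le[OF that] by simp
  qed
  have "x s \<in> interior S" if "s \<in> {t0..t}" for s
  proof (rule ccontr)
    assume s: "x s \<notin> interior S"
    \<comment> \<open>Leaving the interior, rather than \<open>S\<close>, makes the set of exit
      times closed, so that its infimum is a first exit time.\<close>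
    define B where "B = {t0..t} \<inter> x -` (- interior S)"
    have contt: "continuous_on {t0..t} x"
      using cont t by (auto intro: continuous_on_subset)
    then have "closed B"
      unfolding B_def by (intro continuous_closed_preimage) auto
    moreover have "s \<in> B" using s that by (auto simp: B_def)
    moreover have bdd: "bdd_below B" by (auto simp: B_def intro: bdd_belowI)
    ultimately have B: "Inf B \<in> B"
      by (intro closed_contains_Inf) auto
    define b where "b = Inf B"
    have b: "t0 \<le> b" "b \<le> t" "x b \<notin> interior S"
      using B by (auto simp: b_def B_def)
    have less: "x r \<in> interior S" if "t0 \<le> r" "r < b" for r
      using that b(2) cInf_lower[OF _ bdd, of r] by (force simp: b_def B_def)
    have lessS: "x r \<in> S" if "t0 \<le> r" "r < b" for r
      using less[OF that] interior_subset by blast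
    \<comment> \<open>The exit point is a limit of earlier points of the closed set
      \<open>S\<close>, or the initial point.\<close>
    have "x b \<in> S"
    proof (cases "t0 < b")
      case True
      have "closed ({t0..t} \<inter> x -` S)"
        using contt \<open>closed S\<close> by (intro continuous_closed_preimage) auto
      moreover have "{t0<..<b} \<subseteq> {t0..t} \<inter> x -` S"
        using lessS b by auto
      ultimately have "closure {t0<..<b} \<subseteq> {t0..t} \<inter> x -` S"
        by (rule closure_minimal[rotated])
      moreover have "b \<in> closure {t0<..<b}" using True by simp
      ultimately show ?thesis by blast
    qed (use b x0 in auto)
    moreover from this have "x r \<in> S" if "r \<in> {t0..b}" for r
      using that lessS[of r] by (cases "r = b") auto
    ultimately show False
      using trap[of "x b"] V_le0[of b] b t by auto
  qed
  then have "x s \<in> S" if "s \<in> {t0..t}" for s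
    using that interior_subset[of S] by blast
  then show ?thesis using V_le t by auto
qed

text \<open>\<open>F\<close> is Lipschitz only on balls, so existence is first obtained for
  \<open>F\<close> composed with the projection onto a large ball. The decay estimate keeps that
  solution inside the ball, where the projection is the identity. The comparison functions are then
  a linear \<open>\<eta>\<close> and an exponential \<open>\<sigma>\<close>.\<close>

lemma UAS_on_cball_of_exp_decay:
  fixes F :: "'a::euclidean_space \<Rightarrow> 'a"
  assumes lip: "\<And>r. \<exists>L. L-lipschitz_on (cball 0 r) F"
    and decay: "\<And>x t0 T t. ode_solution (\<lambda>t. F) {t0..<T} x \<Longrightarrow> norm (x t0) \<le> \<Delta> \<Longrightarrow>
      t \<in> {t0..<T} \<Longrightarrow> norm (x t) \<le> \<kappa> * norm (x t0) * exp (- \<alpha> * (t - t0))"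
    and "0 < \<Delta>" "0 < \<kappa>" "0 < \<alpha>"
  shows "UAS_on (\<lambda>t. F) (cball 0 \<Delta>)"
proof -
  have ex: "\<exists>x. ode_solution (\<lambda>t. F) {t0..} x \<and> x t0 = x0" if x0: "norm x0 \<le> \<Delta>" for t0 x0
  proof -
    \<comment> \<open>Larger than both the a priori bound \<open>\<kappa> * \<Delta>\<close> and the
      initial norm; the slack 1 gives the contradiction at the first time \<open>b\<close> at which
      the norm reaches \<open>r\<close>.\<close>
    define r where "r = \<kappa> * \<Delta> + \<Delta> + 1"
    have "0 < r" using assms(3-5) by (simp add: r_def add_pos_pos)
    define P where "P = closest_point (cball (0 :: 'a) r)"
    have P_in: "P y \<in> cball 0 r" for y
      unfolding P_def using \<open>0 < r\<close> by (intro closest_point_in_set) auto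
    have P_eq: "P y = y" if "norm y \<le> r" for y
      unfolding P_def using that by (intro closest_point_self) auto
    obtain L where L: "L-lipschitz_on (cball 0 r) F" using lip by blast
    have "1-lipschitz_on UNIV P"
      unfolding P_def using \<open>0 < r\<close>
      by (intro lipschitz_onI) (auto intro!: closest_point_lipschitz)
    moreover have "L-lipschitz_on (range P) F"
      using P_in by (intro lipschitz_on_subset[OF L]) auto
    ultimately have "(L * 1)-lipschitz_on UNIV (\<lambda>y. F (P y))"
      by (rule lipschitz_on_compose2)
    then have "(max L 1)-lipschitz_on UNIV (\<lambda>y. F (P y))"
      by (rule lipschitz_on_le) simp
    then obtain x where sol: "ode_solution (\<lambda>t y. F (P y)) {t0..} x" and "x t0 = x0"
      using lipschitz_global_solution[of "max L 1" "\<lambda>y. F (P y)" t0 x0] by (auto simp: less_max_iff_disj)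
    have cont: "continuous_on {t0..} x"
      using sol unfolding ode_solution_def by (intro continuous_on_vector_derivative) blast
    have less: "norm (x t) < r" if "t0 \<le> t" for t
    proof (rule ccontr)
      assume "\<not> norm (x t) < r"
      define B where "B = {t0..} \<inter> (\<lambda>s. norm (x s)) -` {r..}"
      have "closed B"
        unfolding B_def using cont by (intro continuous_closed_preimage continuous_intros) auto
      moreover have "t \<in> B" using that \<open>\<not> norm (x t) < r\<close> by (auto simp: B_def)
      moreover have bdd: "bdd_below B" by (auto simp: B_def)
      ultimately have B: "Inf B \<in> B"
        by (intro closed_contains_Inf) auto
      define b where "b = Inf B"
      have b: "t0 \<le> b" "r \<le> norm (x b)"
        using B by (auto simp: b_def B_def)
      have before: "norm (x s) < r" if "t0 \<le> s" "s < b" for s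
        using that cInf_lower[OF _ bdd, of s] by (force simp: b_def B_def)
      have "0 < \<kappa> * \<Delta>" using assms(3-5) by simp
      then have "norm (x t0) < r" using x0 \<open>x t0 = x0\<close> by (simp add: r_def)
      then have "t0 < b" using b by (cases "t0 = b") auto
      \<comment> \<open>Before \<open>b\<close> the projected equation is the original one, so
        \<open>decay\<close> applies on this half-open interval and its bound passes to
        \<open>b\<close> by continuity.\<close>
      have "ode_solution (\<lambda>t. F) {t0..<b} x"
        unfolding ode_solution_def
      proof
        fix s assume s: "s \<in> {t0..<b}"
        then have "(x has_vector_derivative F (P (x s))) (at s within {t0..})"
          using sol by (simp add: ode_solution_def)
        then have "(x has_vector_derivative F (P (x s))) (at s within {t0..<b})"
          by (rule has_vector_derivative_within_subset) auto
        then show "(x has_vector_derivative F (x s)) (at s within {t0..<b})"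
          using P_eq[of "x s"] before[of s] s by simp
      qed
      have "norm (x s) \<le> \<kappa> * \<Delta>" if s: "s \<in> {t0..<b}" for s
      proof -
        have "norm (x s) \<le> \<kappa> * norm (x t0) * exp (- \<alpha> * (s - t0))"
          using decay \<open>ode_solution (\<lambda>t. F) {t0..<b} x\<close> x0 \<open>x t0 = x0\<close> s by blast
        also have "\<dots> \<le> (\<kappa> * \<Delta>) * 1"
          using x0 \<open>x t0 = x0\<close> s assms(3-5) by (intro mult_mono) auto
        finally show ?thesis by simp
      qed
      moreover have "b \<in> closure {t0..<b}" using \<open>t0 < b\<close> by simp
      moreover have "continuous_on (closure {t0..<b}) (\<lambda>s. norm (x s))"
        using \<open>t0 < b\<close> by (auto intro!: continuous_intros continuous_on_subset[OF cont])
      ultimately have "norm (x b) \<le> \<kappa> * \<Delta>"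
        using continuous_le_on_closure[of "{t0..<b}" "\<lambda>s. norm (x s)" b "\<kappa> * \<Delta>"] by blast
      then show False using b \<open>0 < \<Delta>\<close> by (simp add: r_def)
    qed
    have "P (x s) = x s" if "t0 \<le> s" for s
      using P_eq[of "x s"] less[OF that] by simp
    then have "ode_solution (\<lambda>t. F) {t0..} x"
      using sol by (simp add: ode_solution_def)
    then show ?thesis using \<open>x t0 = x0\<close> by blast
  qed
  define \<eta> where "\<eta> r = \<kappa> * r" for r :: real
  define \<sigma> where "\<sigma> s = \<kappa> * \<Delta> * exp (- \<alpha> * s)" for s :: real
  have "class_K_infty \<eta>"
    unfolding class_K_infty_def
  proof (intro conjI)
    show "\<not> bdd_above (\<eta> ` {0..})"
    proof
      assume "bdd_above (\<eta> ` {0..})"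
      then obtain m where m: "\<And>r. 0 \<le> r \<Longrightarrow> \<kappa> * r \<le> m"
        by (auto simp: bdd_above_def \<eta>_def)
      have "\<kappa> * ((\<bar>m\<bar> + 1) / \<kappa>) \<le> m" using \<open>0 < \<kappa>\<close> by (intro m) simp
      then show False using \<open>0 < \<kappa>\<close> by simp
    qed
  qed (use \<open>0 < \<kappa>\<close> in \<open>auto simp: \<eta>_def intro!: continuous_intros strict_mono_onI\<close>)
  moreover have "class_L \<sigma>"
    unfolding class_L_def
  proof (intro conjI)
    have "filterlim (\<lambda>s. \<alpha> * s) at_top at_top"
      using \<open>0 < \<alpha>\<close> by (intro filterlim_tendsto_pos_mult_at_top[OF tendsto_const] filterlim_ident)
    then have "((\<lambda>s. exp (- (\<alpha> * s))) \<longlongrightarrow> 0) at_top"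
      by (intro filterlim_compose[OF exp_at_bot] filterlim_compose[OF filterlim_uminus_at_bot_at_top])
    from tendsto_mult_left[OF this, of "\<kappa> * \<Delta>"] show "(\<sigma> \<longlongrightarrow> 0) at_top"
      by (simp add: \<sigma>_def[abs_def])
  qed (use assms(3-5) in \<open>auto simp: \<sigma>_def intro!: continuous_intros monotone_onI mult_left_mono\<close>)
  moreover have "norm (x t) \<le> \<eta> (norm (x t0)) \<and> norm (x t) \<le> \<sigma> (t - t0)"
    if "ode_solution (\<lambda>t. F) {t0..<T} x" "norm (x t0) \<le> \<Delta>" "t \<in> {t0..<T}" for x t0 T t
  proof
    have "norm (x t) \<le> \<kappa> * norm (x t0) * exp (- \<alpha> * (t - t0))"
      using that by (rule decay)
    also have "\<dots> \<le> \<kappa> * norm (x t0) * 1"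
      using that assms(3-5) by (intro mult_left_mono) auto
    finally show "norm (x t) \<le> \<eta> (norm (x t0))" by (simp add: \<eta>_def)
    have "norm (x t) \<le> \<kappa> * norm (x t0) * exp (- \<alpha> * (t - t0))"
      using that by (rule decay)
    also have "\<dots> \<le> \<kappa> * \<Delta> * exp (- \<alpha> * (t - t0))"
      using that assms(3-5) by (intro mult_right_mono mult_left_mono) auto
    finally show "norm (x t) \<le> \<sigma> (t - t0)" by (simp add: \<sigma>_def)
  qed
  ultimately show ?thesis
    unfolding UAS_on_def using ex by (intro exI[of _ \<eta>] exI[of _ \<sigma>]) auto
qed

section \<open>Manipulator dynamics\<close>

lemma twice_cont_diff_has_derivative:
  assumes "twice_cont_diff f"
  shows "(f has_derivative frechet_derivative f (at x)) (at x)"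
  using assms frechet_derivative_works differentiable_def unfolding twice_cont_diff_def by blast

text \<open>The derivative is continuous, hence bounded on the compact ball, and convexity of the
  ball gives the mean value estimate.\<close>

lemma twice_cont_diff_lipschitz_on_cball:
  fixes f :: "'a::euclidean_space \<Rightarrow> 'b::real_normed_vector"
  assumes "twice_cont_diff f"
  obtains L where "L-lipschitz_on (cball a r) f"
proof -
  obtain f' :: "'a \<Rightarrow> 'a \<Rightarrow>\<^sub>L 'b" and f'' :: "'a \<Rightarrow> 'a \<Rightarrow>\<^sub>L ('a \<Rightarrow>\<^sub>L 'b)"
    where f': "\<And>x. (f has_derivative blinfun_apply (f' x)) (at x)"
      and f'': "\<And>x. (f' has_derivative blinfun_apply (f'' x)) (at x)"
    using assms unfolding twice_cont_diff_def by blast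
  have "continuous_on (cball a r) f'"
    using f'' has_derivative_continuous by (blast intro: continuous_at_imp_continuous_on)
  then have "bounded (f' ` cball a r)"
    by (intro compact_imp_bounded compact_continuous_image) auto
  then obtain B where B: "0 < B" "\<And>x. x \<in> cball a r \<Longrightarrow> norm (f' x) \<le> B"
    unfolding bounded_pos by blast
  have "B-lipschitz_on (cball a r) f"
  proof (rule bounded_derivative_imp_lipschitz)
    show "(f has_derivative blinfun_apply (f' x)) (at x within cball a r)" for x
      using f' has_derivative_at_withinI by blast
    show "onorm (blinfun_apply (f' x)) \<le> B" if "x \<in> cball a r" for x
      using B that by (simp add: norm_blinfun.rep_eq)
  qed (use B in auto)
  then show ?thesis by (rule that)
qed

text \<open>Both factors are bounded on the bounded set \<open>S\<close>, so the difference of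
  products can be split with one factor changing at a time. It serves the Coriolis force, the
  product of \<open>C q w\<close> with \<open>w\<close>.\<close>

lemma lipschitz_on_bounded_bilinear:
  fixes f :: "'x::heine_borel \<Rightarrow> 'a::euclidean_space" and h :: "'x \<Rightarrow> 'b::euclidean_space"
    and prod :: "'a \<Rightarrow> 'b \<Rightarrow> 'c::real_normed_vector"
  assumes "bounded_bilinear prod" and f: "A-lipschitz_on S f" and h: "B-lipschitz_on S h"
    and "bounded S"
  obtains L where "L-lipschitz_on S (\<lambda>x. prod (f x) (h x))"
proof -
  interpret bounded_bilinear prod by fact
  have "bounded (f ` S)" "bounded (h ` S)"
    using lipschitz_on_uniformly_continuous[OF f] lipschitz_on_uniformly_continuous[OF h] \<open>bounded S\<close>
    by (auto intro: bounded_uniformly_continuous_image)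
  then obtain a b where a: "0 < a" "\<And>x. x \<in> S \<Longrightarrow> norm (f x) \<le> a"
    and b: "0 < b" "\<And>x. x \<in> S \<Longrightarrow> norm (h x) \<le> b"
    unfolding bounded_pos by blast
  obtain K where K: "0 \<le> K" "\<And>a b. norm (prod a b) \<le> norm a * norm b * K"
    using nonneg_bounded by blast
  note AB = lipschitz_on_nonneg[OF f] lipschitz_on_nonneg[OF h]
  have "(A * b * K + a * B * K)-lipschitz_on S (\<lambda>x. prod (f x) (h x))"
  proof (rule lipschitz_onI)
    fix x y assume xy: "x \<in> S" "y \<in> S"
    have fxy: "norm (f x - f y) \<le> A * dist x y" and hxy: "norm (h x - h y) \<le> B * dist x y"
      using lipschitz_onD[OF f xy] lipschitz_onD[OF h xy] by (simp_all add: dist_norm)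
    have "prod (f x) (h x) - prod (f y) (h y) = prod (f x - f y) (h x) + prod (f y) (h x - h y)"
      by (simp add: diff_left diff_right)
    also have "norm \<dots> \<le> norm (f x - f y) * norm (h x) * K + norm (f y) * norm (h x - h y) * K"
      by (intro norm_triangle_le add_mono K)
    also have "\<dots> \<le> (A * dist x y) * b * K + a * (B * dist x y) * K"
      using a b fxy hxy xy K AB
      by (intro add_mono mult_right_mono[OF mult_mono]) auto
    finally show "dist (prod (f x) (h x)) (prod (f y) (h y)) \<le> (A * b * K + a * B * K) * dist x y"
      by (simp add: dist_norm algebra_simps)
  qed (use AB a b K in simp)
  then show ?thesis by (rule that)
qed

lemma bounded_bilinear_matrix_vector_mult:
  "bounded_bilinear ((*v) :: real^'n^'m \<Rightarrow> real^'n \<Rightarrow> real^'m)"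
  unfolding bilinear_conv_bounded_bilinear[symmetric] bilinear_def
  by (auto intro!: linearI simp: matrix_vector_mult_add_rdistrib scaleR_matrix_vector_assoc)

lemma has_real_derivative_inner:
  assumes "(a has_vector_derivative a') (at t within S)" "(b has_vector_derivative b') (at t within S)"
  shows "((\<lambda>t. a t \<bullet> b t) has_real_derivative a t \<bullet> b' + a' \<bullet> b t) (at t within S)"
  using bounded_bilinear.has_vector_derivative[OF bounded_bilinear_inner assms]
  by (simp add: has_real_derivative_iff_has_vector_derivative)

text \<open>Young's inequality; the weight \<open>m\<close> decides which of the two squares pays
  for a cross term.\<close>

lemma abs_inner_le_weighted_squares:
  fixes x y :: "'a::real_inner"
  assumes "0 < m"
  shows "\<bar>x \<bullet> y\<bar> \<le> m * (norm x)\<^sup>2 + (norm y)\<^sup>2 / (4 * m)"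
proof -
  have "0 \<le> (2 * m * norm x - norm y)\<^sup>2" by simp
  then have "norm x * norm y \<le> m * (norm x)\<^sup>2 + (norm y)\<^sup>2 / (4 * m)"
    using assms by (simp add: power2_eq_square field_simps)
  then show ?thesis
    using Cauchy_Schwarz_ineq2[of x y] by linarith
qed

lemma bounded_linear_transpose: "bounded_linear (transpose :: real^'n^'m \<Rightarrow> real^'m^'n)"
  unfolding linear_conv_bounded_linear[symmetric]
  by (intro linearI) (simp_all add: transpose_def vec_eq_iff)

lemma inner_transpose:
  fixes A :: "real^'n^'m"
  shows "x \<bullet> (transpose A *v y) = y \<bullet> (A *v x)"
  by (metis dot_lmul_matrix inner_commute transpose_matrix_vector)

section \<open>Inertia, Coriolis and gravity estimates\<close>

locale manipulator =
  fixes D :: "real^'n \<Rightarrow> real^'n^'n"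
    and C :: "real^'n \<Rightarrow> real^'n \<Rightarrow> real^'n^'n"
    and g :: "real^'n \<Rightarrow> real^'n"
    and U :: "real^'n \<Rightarrow> real"
    and qs :: "real^'n"
    and dM kc kg :: real
  assumes D_transpose: "transpose (D q) = D q"
    and D_pos: "positive_definite (D q)"
    and skew: "transpose (frechet_derivative D (at q) w - 2 *\<^sub>R C q w)
        = - (frechet_derivative D (at q) w - 2 *\<^sub>R C q w)"
    and U_deriv: "(U has_derivative (\<lambda>h. g q \<bullet> h)) (at q)"
    and D_smooth: "twice_cont_diff D"
    and C_smooth: "twice_cont_diff (\<lambda>(q, w). C q w)"
    and g_smooth: "twice_cont_diff g"
    and consts_pos: "0 < dM" "0 < kc" "0 < kg"
    and D_norm: "matrix_norm (D q) \<le> dM"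
    and C_norm: "matrix_norm (C q w) \<le> kc * norm w"
    and g_deriv_norm: "onorm (frechet_derivative g (at q)) \<le> kg"
begin

abbreviation "D' q w \<equiv> frechet_derivative D (at q) w"

lemma D_sym: "x \<bullet> (D q *v y) = y \<bullet> (D q *v x)"
  using inner_transpose[of x "D q" y] by (simp add: D_transpose)

lemma D_nonneg: "0 \<le> x \<bullet> (D q *v x)"
  using D_pos[of q] unfolding positive_definite_def by (cases "x = 0") (auto simp: less_imp_le)

lemma D_bound: "norm (D q *v x) \<le> dM * norm x"
  using onorm[OF matrix_vector_mul_bounded_linear, of "D q" x] D_norm[of q]
  by (meson mult_right_mono norm_ge_zero order_trans)

lemma C_bound: "norm (C q w *v x) \<le> kc * norm w * norm x"
  using onorm[OF matrix_vector_mul_bounded_linear, of "C q w" x] C_norm[of q w]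
  by (meson mult_right_mono norm_ge_zero order_trans)

lemma D_quadratic_bound: "x \<bullet> (D q *v x) \<le> dM * (norm x)\<^sup>2"
proof -
  have "x \<bullet> (D q *v x) \<le> norm x * norm (D q *v x)" by (rule norm_cauchy_schwarz)
  also have "\<dots> \<le> norm x * (dM * norm x)" by (intro mult_left_mono D_bound) simp
  finally show ?thesis by (simp add: power2_eq_square ac_simps)
qed

text \<open>Young's inequality for the form of \<open>D q\<close>: expand its nonnegativity at
  \<open>m *\<^sub>R x - s *\<^sub>R y\<close>, with \<open>s = 1\<close> and \<open>s = - 1\<close>
  for the two signs.\<close>

lemma D_weighted_cauchy_schwarz:
  assumes "0 < m"
  shows "\<bar>x \<bullet> (D q *v y)\<bar> \<le> m / 2 * (x \<bullet> (D q *v x)) + (y \<bullet> (D q *v y)) / (2 * m)"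
proof -
  have le: "s * (x \<bullet> (D q *v y)) \<le> m / 2 * (x \<bullet> (D q *v x)) + (y \<bullet> (D q *v y)) / (2 * m)"
    if "s * s = 1" for s :: real
  proof -
    have "0 \<le> (m *\<^sub>R x - s *\<^sub>R y) \<bullet> (D q *v (m *\<^sub>R x - s *\<^sub>R y))" by (rule D_nonneg)
    also have "\<dots> = m * m * (x \<bullet> (D q *v x)) - 2 * m * (s * (x \<bullet> (D q *v y))) + (s * s) * (y \<bullet> (D q *v y))"
      by (simp add: matrix_vector_mult_diff_distrib matrix_vector_mult_scaleR
          inner_diff_left inner_diff_right D_sym[of y q x] algebra_simps)
    finally show ?thesis
      using assms by (simp add: that field_simps)
  qed
  show ?thesis
    using le[of 1] le[of "- 1"] by (simp add: abs_le_iff)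
qed

text \<open>
  The hypothesis \<open>dm \<le> matrix_norm (D q)\<close> bounds only the largest eigenvalue of \<open>D q\<close> from below, so
  coercivity comes from compactness and holds only locally in \<open>q\<close>.
\<close>

lemma D_coercive_on_cball:
  assumes "0 \<le> r"
  obtains l where "0 < l" "\<And>q x. q \<in> cball a r \<Longrightarrow> l * (norm x)\<^sup>2 \<le> x \<bullet> (D q *v x)"
proof -
  define S where "S = cball a r \<times> sphere (0 :: real^'n) 1"
  have contD: "continuous_on UNIV D"
    using twice_cont_diff_has_derivative[OF D_smooth] has_derivative_continuous
    by (blast intro: continuous_at_imp_continuous_on)
  have "continuous_on S (\<lambda>p. snd p \<bullet> (D (fst p) *v snd p))"
    by (intro continuous_on_inner continuous_on_snd continuous_on_id
        bounded_bilinear.continuous_on[OF bounded_bilinear_matrix_vector_mult]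
        continuous_on_compose2[OF contD] continuous_on_fst) auto
  moreover have "compact S" unfolding S_def by (intro compact_Times) auto
  moreover obtain v :: "real^'n" where "norm v = 1"
    using vector_choose_size[of 1] by auto
  then have "S \<noteq> {}" using assms unfolding S_def by auto
  ultimately obtain p where p: "p \<in> S"
    "\<And>y. y \<in> S \<Longrightarrow> snd p \<bullet> (D (fst p) *v snd p) \<le> snd y \<bullet> (D (fst y) *v snd y)"
    using continuous_attains_inf[of S "\<lambda>p. snd p \<bullet> (D (fst p) *v snd p)"] by blast
  define l where "l = snd p \<bullet> (D (fst p) *v snd p)"
  show ?thesis
  proof (rule that)
    have "snd p \<noteq> 0" using p(1) by (auto simp: S_def)
    then show "0 < l" using D_pos[of "fst p"] by (simp add: l_def positive_definite_def)
    fix q x assume q: "q \<in> cball a r"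
    show "l * (norm x)\<^sup>2 \<le> x \<bullet> (D q *v x)"
    proof (cases "x = 0")
      case False
      let ?y = "(1 / norm x) *\<^sub>R x"
      have "(q, ?y) \<in> S" using q False by (simp add: S_def)
      from p(2)[OF this] have "l \<le> ?y \<bullet> (D q *v ?y)" by (simp add: l_def)
      also have "\<dots> = (x \<bullet> (D q *v x)) / (norm x)\<^sup>2"
        by (simp add: matrix_vector_mult_scaleR power2_eq_square)
      finally show ?thesis using False by (simp add: field_simps)
    qed simp
  qed
qed

lemma D'_transpose: "transpose (D' q w) = D' q w"
proof -
  have D: "(D has_derivative D' q) (at q)"
    by (rule twice_cont_diff_has_derivative[OF D_smooth])
  have "((\<lambda>q. transpose (D q)) has_derivative (\<lambda>w. transpose (D' q w))) (at q)"
    by (rule bounded_linear.has_derivative[OF bounded_linear_transpose D])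
  then have "(\<lambda>w. transpose (D' q w)) = D' q"
    unfolding D_transpose using D by (rule has_derivative_unique)
  then show ?thesis by metis
qed

text \<open>Skew-symmetry of \<open>D' - 2 C\<close> and symmetry of \<open>D'\<close> give
  \<open>D' = C + transpose C\<close>. The two-vector form serves the kinetic energy
  (\<open>x = w\<close>) and also the cross terms (\<open>x = e\<close> and \<open>x = z\<close>),
  where the Coriolis force cancels one summand.\<close>

lemma D'_eq: "x \<bullet> (D' q w *v y) = x \<bullet> (C q w *v y) + y \<bullet> (C q w *v x)"
proof -
  define S where "S = D' q w - 2 *\<^sub>R C q w"
  have "x \<bullet> (S *v y) = y \<bullet> (transpose S *v x)"
    by (rule inner_transpose[symmetric])
  also have "\<dots> = - (y \<bullet> (S *v x))"
    using skew[of q w] by (simp add: S_def[symmetric] bounded_bilinear.minus_left[OF bounded_bilinear_matrix_vector_mult])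
  finally have "x \<bullet> (D' q w *v y) - 2 * (x \<bullet> (C q w *v y)) =
      - (y \<bullet> (D' q w *v x)) + 2 * (y \<bullet> (C q w *v x))"
    by (simp add: S_def matrix_vector_mult_diff_rdistrib inner_diff_right
        flip: scaleR_matrix_vector_assoc)
  moreover have "y \<bullet> (D' q w *v x) = x \<bullet> (D' q w *v y)"
    using inner_transpose[of y "D' q w" x] by (simp add: D'_transpose)
  ultimately show ?thesis by simp
qed

lemma g_lipschitz: "norm (g x - g y) \<le> kg * norm (x - y)"
  by (rule differentiable_bound[of UNIV g "\<lambda>q. frechet_derivative g (at q)"])
    (auto intro: twice_cont_diff_has_derivative[OF g_smooth] g_deriv_norm)

text \<open>First-order Taylor remainder of a function whose gradient \<open>g\<close> is
  Lipschitz.\<close>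

lemma U_quadratic_bound: "\<bar>U (q + e) - U q - g q \<bullet> e\<bar> \<le> kg / 2 * (norm e)\<^sup>2"
proof -
  \<comment> \<open>The sign \<open>s\<close> treats both halves of the absolute value at once. The
    Lipschitz bound on \<open>g\<close> makes the derivative in \<open>r\<close> nonnegative, and
    comparing \<open>r = 0\<close> with \<open>r = 1\<close> gives the estimate.\<close>
  define \<phi> where "\<phi> s r = s * (U (q + r *\<^sub>R e) - r * (g q \<bullet> e)) + kg / 2 * r\<^sup>2 * (norm e)\<^sup>2" for s r :: real
  have "\<phi> s 0 \<le> \<phi> s 1" if s: "\<bar>s\<bar> = 1" for s
  proof (rule DERIV_nonneg_imp_nondecreasing[where f = "\<phi> s"])
    fix r :: real assume r: "0 \<le> r"
    have "((\<lambda>r. U (q + r *\<^sub>R e)) has_derivative (\<lambda>h. g (q + r *\<^sub>R e) \<bullet> (h *\<^sub>R e))) (at r)"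
      by (rule has_derivative_compose[OF _ U_deriv]) (auto intro!: derivative_eq_intros)
    then have U': "((\<lambda>r. U (q + r *\<^sub>R e)) has_real_derivative g (q + r *\<^sub>R e) \<bullet> e) (at r)"
      by (simp add: has_field_derivative_def mult_commute_abs)
    have "(\<phi> s has_real_derivative s * ((g (q + r *\<^sub>R e) - g q) \<bullet> e) + kg * r * (norm e)\<^sup>2) (at r)"
      unfolding \<phi>_def by (auto intro!: derivative_eq_intros U' simp: inner_diff_left)
    moreover have "\<bar>(g (q + r *\<^sub>R e) - g q) \<bullet> e\<bar> \<le> kg * r * (norm e)\<^sup>2"
    proof -
      have "\<bar>(g (q + r *\<^sub>R e) - g q) \<bullet> e\<bar> \<le> norm (g (q + r *\<^sub>R e) - g q) * norm e"
        by (rule Cauchy_Schwarz_ineq2)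
      also have "\<dots> \<le> (kg * norm (q + r *\<^sub>R e - q)) * norm e"
        by (intro mult_right_mono g_lipschitz) simp
      finally show ?thesis using r by (simp add: power2_eq_square ac_simps)
    qed
    then have "0 \<le> s * ((g (q + r *\<^sub>R e) - g q) \<bullet> e) + kg * r * (norm e)\<^sup>2"
      using s by (auto simp: abs_if split: if_splits)
    ultimately show "\<exists>y. DERIV (\<phi> s) r :> y \<and> 0 \<le> y" by blast
  qed simp
  from this[of 1] this[of "- 1"]
  have "U (q + e) - U q - g q \<bullet> e \<le> kg / 2 * (norm e)\<^sup>2"
    "- (U (q + e) - U q - g q \<bullet> e) \<le> kg / 2 * (norm e)\<^sup>2"
    by (simp_all add: \<phi>_def)
  then show ?thesis by (rule abs_leI)
qed

text \<open>Differentiating the momentum instead of the velocity keeps the acceleration in the form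
  \<open>D a\<close>, which the equation of motion replaces by the force without a matrix
  inverse.\<close>

lemma momentum_deriv:
  assumes "(e has_vector_derivative w t) (at t within J)"
    and "(w has_vector_derivative a) (at t within J)"
  shows "((\<lambda>t. D (qs + e t) *v w t) has_vector_derivative
      D (qs + e t) *v a + D' (qs + e t) (w t) *v w t) (at t within J)"
proof -
  have q: "((\<lambda>t. qs + e t) has_vector_derivative w t) (at t within J)"
    using assms(1) by (auto intro!: derivative_eq_intros)
  have "((\<lambda>t. D (qs + e t)) has_vector_derivative D' (qs + e t) (w t)) (at t within J)"
    using vector_derivative_diff_chain_within[OF q
      has_derivative_at_withinI[OF twice_cont_diff_has_derivative[OF D_smooth]]]
    by (simp add: o_def)
  from bounded_bilinear.has_vector_derivative[OF bounded_bilinear_matrix_vector_mult this assms(2)]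
  show ?thesis .
qed

lemma potential_deriv:
  assumes "(e has_vector_derivative e') (at t within J)"
  shows "((\<lambda>t. U (qs + e t)) has_real_derivative g (qs + e t) \<bullet> e') (at t within J)"
proof -
  have q: "((\<lambda>t. qs + e t) has_vector_derivative e') (at t within J)"
    using assms by (auto intro!: derivative_eq_intros)
  show ?thesis
    using vector_derivative_diff_chain_within[OF q has_derivative_at_withinI[OF U_deriv]]
    by (simp add: o_def has_real_derivative_iff_has_vector_derivative)
qed

end

section \<open>The Lyapunov function\<close>

lemma norm_quadruple:
  "(norm (e, w, z, j))\<^sup>2 = (norm e)\<^sup>2 + (norm w)\<^sup>2 + (norm z)\<^sup>2 + (norm j)\<^sup>2"
  by (simp add: norm_Pair)

text \<open>\<open>c\<close> is the decay rate of the current error, \<open>M\<close> the weight of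
  its square in \<open>V\<close>, and \<open>K\<close> the common value of \<open>kp\<close> and
  \<open>kd\<close>. \<open>M_large\<close> lets the current term absorb the perturbing force;
  \<open>K_large\<close> collects all lower bounds on the gain.\<close>

locale pid_loop = manipulator D C g U qs dM kc kg
  for D :: "real^'n \<Rightarrow> real^'n^'n"
    and C :: "real^'n \<Rightarrow> real^'n \<Rightarrow> real^'n^'n"
    and g :: "real^'n \<Rightarrow> real^'n"
    and U :: "real^'n \<Rightarrow> real"
    and qs :: "real^'n"
    and dM kc kg :: real +
  fixes kt c \<Delta> M K :: real
  assumes \<Delta>_pos: "0 < \<Delta>" and c_pos: "0 < c" and M_pos: "0 < M"
    and M_large: "kt\<^sup>2 + 1 \<le> c * M"
    and K_large: "10 + 8 * kg + 8 * dM + 8 * (kc * \<Delta>) + M \<le> K"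
begin

text \<open>Inertia times acceleration, with the control law substituted.\<close>

definition net_force :: "(real^'n) \<times> (real^'n) \<times> (real^'n) \<times> (real^'n) \<Rightarrow> real^'n" where
  "net_force = (\<lambda>(e, w, z, j).
     - (K *\<^sub>R e) - K *\<^sub>R w + z - (g (qs + e) - g qs) + kt *\<^sub>R j - C (qs + e) w *v w)"

text \<open>The closed loop for the gains \<open>(K, K, 1)\<close>, after the cancellations in the
  electrical equation.\<close>

definition field where
  "field = (\<lambda>(e, w, z, j).
     (w, matrix_inv (D (qs + e)) *v net_force (e, w, z, j), - e, - (c *\<^sub>R j)))"

text \<open>Inversely proportional to \<open>K\<close>, so that the terms in
  \<open>z \<bullet> e\<close> and \<open>z \<bullet> w\<close> which the gains produce from the
  cross term have the fixed coefficient 1/16.\<close>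

definition \<gamma> :: real where "\<gamma> = 1 / (16 * K)"

text \<open>Half of \<open>K * (e \<bullet> e)\<close> balances the work of the proportional action,
  the other half the damping term in the derivative of \<open>e \<bullet> D w\<close>. The terms
  \<open>- e \<bullet> z\<close> and \<open>(z \<bullet> z) / 2\<close> cancel the products of the
  integrator state with \<open>w\<close> and \<open>e\<close>.\<close>

definition V :: "(real^'n) \<times> (real^'n) \<times> (real^'n) \<times> (real^'n) \<Rightarrow> real" where
  "V = (\<lambda>(e, w, z, j). (w \<bullet> (D (qs + e) *v w)) / 2 + K * (e \<bullet> e)
     + (U (qs + e) - U qs - g qs \<bullet> e) - e \<bullet> z + e \<bullet> (D (qs + e) *v w) + (z \<bullet> z) / 2
     - \<gamma> * (z \<bullet> (D (qs + e) *v w)) + M / 2 * (j \<bullet> j))"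

lemma kc\<Delta>_pos: "0 < kc * \<Delta>"
  using consts_pos \<Delta>_pos by simp

lemma K_bounds: "10 \<le> K" "kg \<le> K" "8 * dM \<le> K" "M \<le> K" "kg + 2 + 4 * dM \<le> K / 2" "0 < K"
  using K_large consts_pos kc\<Delta>_pos M_pos by linarith+

lemma \<gamma>_bounds: "0 < \<gamma>" "\<gamma> * K = 1 / 16" "\<gamma> \<le> 1 / 16" "\<gamma> * dM \<le> 1 / 16" "\<gamma> * kg \<le> 1 / 16"
proof -
  show "0 < \<gamma>" "\<gamma> * K = 1 / 16" using K_bounds by (simp_all add: \<gamma>_def)
  show "\<gamma> \<le> 1 / 16" "\<gamma> * dM \<le> 1 / 16" "\<gamma> * kg \<le> 1 / 16"
    using K_bounds consts_pos unfolding \<gamma>_def by (simp_all add: field_simps)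
qed

text \<open>The kinetic term and \<open>(norm z)\<^sup>2 / 2\<close> pay for part of the cross terms
  by fixed fractions; whatever falls on \<open>(norm e)\<^sup>2\<close>, gravity included, is at
  most a quarter of \<open>K\<close>.\<close>

lemma V_bounds:
  defines "T \<equiv> \<lambda>e w. w \<bullet> (D (qs + e) *v w)"
  shows "T e w / 4 + K / 2 * (norm e)\<^sup>2 + (norm z)\<^sup>2 / 8 + M / 2 * (norm j)\<^sup>2 \<le> V (e, w, z, j)"
    and "V (e, w, z, j) \<le> T e w + 3 * K / 2 * (norm e)\<^sup>2 + (norm z)\<^sup>2 + M * (norm j)\<^sup>2"
proof -
  define q where "q = qs + e"
  have T: "0 \<le> T e w" unfolding T_def by (rule D_nonneg)
  have U: "\<bar>U q - U qs - g qs \<bullet> e\<bar> \<le> kg * (norm e)\<^sup>2 / 2"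
    using U_quadratic_bound[of qs e] by (simp add: q_def)
  have ez: "\<bar>e \<bullet> z\<bar> \<le> (norm e)\<^sup>2 + (norm z)\<^sup>2 / 4"
    using abs_inner_le_weighted_squares[of 1 e z] by simp
  \<comment> \<open>Weight 4 charges only 1/8 of the kinetic form; the large remainder in
    \<open>e\<close> is left to \<open>K\<close>.\<close>
  have eDw: "\<bar>e \<bullet> (D q *v w)\<bar> \<le> 2 * (dM * (norm e)\<^sup>2) + T e w / 8"
    using D_weighted_cauchy_schwarz[of 4 e q w] D_quadratic_bound[of e q]
    by (simp add: T_def q_def)
  have zDw: "\<bar>\<gamma> * (z \<bullet> (D q *v w))\<bar> \<le> (norm z)\<^sup>2 / 8 + T e w / 8"
  proof -
    have "\<bar>z \<bullet> (D q *v w)\<bar> \<le> dM / 2 * (norm z)\<^sup>2 + T e w / 2"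
      using D_weighted_cauchy_schwarz[of 1 z q w] D_quadratic_bound[of z q]
      by (simp add: T_def q_def)
    then have "\<bar>\<gamma> * (z \<bullet> (D q *v w))\<bar> \<le> \<gamma> * (dM / 2 * (norm z)\<^sup>2 + T e w / 2)"
      using \<gamma>_bounds(1) by (simp add: abs_mult)
    also have "\<dots> = (\<gamma> * dM) * ((norm z)\<^sup>2 / 2) + \<gamma> * (T e w / 2)"
      by (simp add: algebra_simps)
    also have "\<dots> \<le> 1 / 16 * ((norm z)\<^sup>2 / 2) + 1 / 16 * (T e w / 2)"
      using \<gamma>_bounds T by (intro add_mono mult_right_mono) auto
    also have "\<dots> \<le> (norm z)\<^sup>2 / 8 + T e w / 8"
      using T zero_le_power2[of "norm z"] by linarith
    finally show ?thesis .
  qed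
  have "(kg + 2 + 4 * dM) * (norm e)\<^sup>2 \<le> K / 2 * (norm e)\<^sup>2"
    using K_bounds by (intro mult_right_mono) auto
  then have K: "kg * (norm e)\<^sup>2 + 2 * (norm e)\<^sup>2 + 4 * (dM * (norm e)\<^sup>2) \<le> K * (norm e)\<^sup>2 / 2"
    by (simp add: algebra_simps)
  have pos: "0 \<le> kg * (norm e)\<^sup>2" "0 \<le> dM * (norm e)\<^sup>2" "0 \<le> (norm e)\<^sup>2" "0 \<le> (norm z)\<^sup>2"
    using consts_pos by simp_all
  have M: "0 \<le> M * (norm j)\<^sup>2" using M_pos by simp
  have V: "V (e, w, z, j) = T e w / 2 + K * (norm e)\<^sup>2 + (U q - U qs - g qs \<bullet> e) - e \<bullet> z
      + e \<bullet> (D q *v w) + (norm z)\<^sup>2 / 2 - \<gamma> * (z \<bullet> (D q *v w)) + M / 2 * (norm j)\<^sup>2"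
    by (simp add: V_def T_def q_def power2_norm_eq_inner)
  show "T e w / 4 + K / 2 * (norm e)\<^sup>2 + (norm z)\<^sup>2 / 8 + M / 2 * (norm j)\<^sup>2 \<le> V (e, w, z, j)"
    using T U ez eDw zDw K pos unfolding V abs_le_iff by linarith
  show "V (e, w, z, j) \<le> T e w + 3 * K / 2 * (norm e)\<^sup>2 + (norm z)\<^sup>2 + M * (norm j)\<^sup>2"
    using T U ez eDw zDw K M pos unfolding V abs_le_iff by linarith
qed

text \<open>\<open>K\<close> dominates \<open>dM\<close>, \<open>1\<close> and \<open>M\<close>, so
  the coefficient of \<open>(norm e)\<^sup>2\<close> serves for all four components.\<close>

lemma V_le: "V x \<le> 3 * K / 2 * (norm x)\<^sup>2"
proof -
  obtain e w z j where x: "x = (e, w, z, j)" by (metis prod_cases4)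
  have "V x \<le> w \<bullet> (D (qs + e) *v w) + 3 * K / 2 * (norm e)\<^sup>2 + (norm z)\<^sup>2 + M * (norm j)\<^sup>2"
    unfolding x by (rule V_bounds(2))
  also have "\<dots> \<le> 3 * K / 2 * (norm w)\<^sup>2 + 3 * K / 2 * (norm e)\<^sup>2 + 3 * K / 2 * (norm z)\<^sup>2 + 3 * K / 2 * (norm j)\<^sup>2"
  proof (intro add_mono order_refl)
    show "w \<bullet> (D (qs + e) *v w) \<le> 3 * K / 2 * (norm w)\<^sup>2"
      using K_bounds consts_pos by (intro order_trans[OF D_quadratic_bound mult_right_mono]) auto
    show "(norm z)\<^sup>2 \<le> 3 * K / 2 * (norm z)\<^sup>2"
      using K_bounds mult_right_mono[of 1 "3 * K / 2" "(norm z)\<^sup>2"] by simp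
    show "M * (norm j)\<^sup>2 \<le> 3 * K / 2 * (norm j)\<^sup>2"
      using K_bounds by (intro mult_right_mono) auto
  qed
  finally show ?thesis unfolding x norm_quadruple by (simp add: algebra_simps)
qed

text \<open>
  The derivative of \<open>V\<close> along the motion, after cancellation of \<open>K e \<bullet> w\<close>, \<open>w \<bullet> z\<close>, \<open>e \<bullet> z\<close> and, through
  the skew-symmetry, of the Coriolis term in the kinetic energy.
\<close>

definition V' :: "(real^'n) \<times> (real^'n) \<times> (real^'n) \<times> (real^'n) \<Rightarrow> real" where
  "V' = (\<lambda>(e, w, z, j). let q = qs + e; h = g (qs + e) - g qs in
     - K * (w \<bullet> w) + w \<bullet> (kt *\<^sub>R j) + e \<bullet> e + w \<bullet> (D q *v w) + w \<bullet> (C q w *v e)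
     - K * (e \<bullet> e) - e \<bullet> h + e \<bullet> (kt *\<^sub>R j)
     + \<gamma> * (e \<bullet> (D q *v w)) - \<gamma> * (w \<bullet> (C q w *v z)) + (z \<bullet> e) / 16 + (z \<bullet> w) / 16
     - \<gamma> * (z \<bullet> z) + \<gamma> * (z \<bullet> h) - \<gamma> * (z \<bullet> (kt *\<^sub>R j)) - c * M * (j \<bullet> j))"

lemma V_has_derivative:
  assumes "ode_solution (\<lambda>t. field) J x" and "t \<in> J"
  shows "((\<lambda>t. V (x t)) has_real_derivative V' (x t)) (at t within J)"
proof -
  define e where "e t = fst (x t)" for t
  define w where "w t = fst (snd (x t))" for t
  define z where "z t = fst (snd (snd (x t)))" for t
  define j where "j t = snd (snd (snd (x t)))" for t
  have x: "x = (\<lambda>t. (e t, w t, z t, j t))"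
    by (simp add: e_def w_def z_def j_def)
  define q where "q = qs + e t"
  define F where "F = net_force (e t, w t, z t, j t)"
  define a where "a = matrix_inv (D q) *v F"
  have "((\<lambda>t. (e t, w t, z t, j t)) has_vector_derivative (w t, a, - e t, - (c *\<^sub>R j t))) (at t within J)"
    using assms unfolding ode_solution_def x by (simp add: field_def a_def F_def q_def)
  then have e': "(e has_vector_derivative w t) (at t within J)"
    and w': "(w has_vector_derivative a) (at t within J)"
    and z': "(z has_vector_derivative - e t) (at t within J)"
    and j': "(j has_vector_derivative - (c *\<^sub>R j t)) (at t within J)"
    unfolding has_vector_derivative_prod_iff by blast+
  have Da: "D q *v a = F"
    unfolding a_def using positive_definite_inverse[OF D_pos[of q]]
    by (simp add: matrix_vector_mul_assoc)
  define p where "p t = D (qs + e t) *v w t" for t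
  have p': "(p has_vector_derivative F + D' q (w t) *v w t) (at t within J)"
    unfolding p_def[abs_def] using momentum_deriv[OF e' w'] by (simp add: Da flip: q_def)
  have pt: "p t = D q *v w t" by (simp add: p_def q_def)
  \<comment> \<open>The momentum \<open>p\<close> is differentiated as a single signal; the
    derivative is left unsimplified so that it matches the differentiation rules.\<close>
  have "((\<lambda>t. (w t \<bullet> p t) / 2 + K * (e t \<bullet> e t)
     + (U (qs + e t) - U qs - g qs \<bullet> e t) - e t \<bullet> z t + e t \<bullet> p t + (z t \<bullet> z t) / 2
     - \<gamma> * (z t \<bullet> p t) + M / 2 * (j t \<bullet> j t)) has_real_derivative
     (w t \<bullet> (F + D' q (w t) *v w t) + a \<bullet> p t) / 2 + K * (e t \<bullet> w t + w t \<bullet> e t)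
     + (g q \<bullet> w t - 0 - (g qs \<bullet> w t + 0 \<bullet> e t)) - (e t \<bullet> (- e t) + w t \<bullet> z t)
     + (e t \<bullet> (F + D' q (w t) *v w t) + w t \<bullet> p t)
     + (z t \<bullet> (- e t) + (- e t) \<bullet> z t) / 2
     - \<gamma> * (z t \<bullet> (F + D' q (w t) *v w t) + (- e t) \<bullet> p t)
     + M / 2 * (j t \<bullet> (- (c *\<^sub>R j t)) + (- (c *\<^sub>R j t)) \<bullet> j t)) (at t within J)"
    unfolding q_def
    by (intro DERIV_add DERIV_diff DERIV_cdivide DERIV_cmult DERIV_const potential_deriv
        has_real_derivative_inner e' w' z' j' p'[unfolded q_def] has_vector_derivative_const)
  moreover have "(\<lambda>t. V (x t)) = (\<lambda>t. (w t \<bullet> p t) / 2 + K * (e t \<bullet> e t)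
     + (U (qs + e t) - U qs - g qs \<bullet> e t) - e t \<bullet> z t + e t \<bullet> p t + (z t \<bullet> z t) / 2
     - \<gamma> * (z t \<bullet> p t) + M / 2 * (j t \<bullet> j t))"
    by (simp add: x V_def p_def)
  moreover have "(w t \<bullet> (F + D' q (w t) *v w t) + a \<bullet> p t) / 2 + K * (e t \<bullet> w t + w t \<bullet> e t)
     + (g q \<bullet> w t - 0 - (g qs \<bullet> w t + 0 \<bullet> e t)) - (e t \<bullet> (- e t) + w t \<bullet> z t)
     + (e t \<bullet> (F + D' q (w t) *v w t) + w t \<bullet> p t)
     + (z t \<bullet> (- e t) + (- e t) \<bullet> z t) / 2
     - \<gamma> * (z t \<bullet> (F + D' q (w t) *v w t) + (- e t) \<bullet> p t)
     + M / 2 * (j t \<bullet> (- (c *\<^sub>R j t)) + (- (c *\<^sub>R j t)) \<bullet> j t) = V' (x t)"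
  proof -
    \<comment> \<open>Symmetry of \<open>D\<close> turns the acceleration term of the kinetic energy
      into the power of \<open>F\<close>.\<close>
    have ap: "a \<bullet> (D q *v w t) = w t \<bullet> F"
      using D_sym[of a q "w t"] by (simp add: Da)
    have F: "F = - (K *\<^sub>R e t) - K *\<^sub>R w t + z t - (g q - g qs) + kt *\<^sub>R j t - C q (w t) *v w t"
      by (simp add: F_def net_force_def q_def)
    have \<gamma>K: "K * (\<gamma> * s) = s / 16" for s
      using arg_cong[OF \<gamma>_bounds(2), of "\<lambda>r. r * s"] by (simp add: ac_simps)
    show ?thesis
      unfolding x V'_def Let_def prod.case q_def[symmetric]
      by (simp add: pt ap D'_eq add_divide_distrib diff_divide_distrib inner_add_right inner_diff_right F \<gamma>K
          inner_commute[of "w t" "e t"] inner_commute[of "w t" "z t"] inner_commute[of "z t" "e t"]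
          inner_commute[of "w t" "g q"] inner_commute[of "w t" "g qs"] algebra_simps)
  qed
  ultimately show ?thesis by simp
qed

section \<open>Dissipation estimate\<close>

text \<open>The bounds on \<open>e\<close> and \<open>z\<close> turn the cubic Coriolis terms into
  multiples of \<open>(norm w)\<^sup>2\<close>. The bound on \<open>z\<close> grows with
  \<open>K\<close>, but its term carries \<gamma> and \<open>\<gamma> * K\<close> is constant, so
  \<open>K\<close> can still dominate.\<close>

lemma V'_decay:
  assumes e: "norm e \<le> 2 * \<Delta>" and z: "norm z \<le> 4 * K * \<Delta>"
  shows "V' (e, w, z, j) \<le> - (1 / (32 * K)) * (norm (e, w, z, j))\<^sup>2"
proof -
  define q where "q = qs + e"
  define h where "h = g q - g qs"
  define a b d m where "a = (norm e)\<^sup>2" "b = (norm w)\<^sup>2" "d = (norm z)\<^sup>2" "m = (norm j)\<^sup>2"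
  note sq = a_b_d_m_def
  have nonneg: "0 \<le> a" "0 \<le> b" "0 \<le> d" "0 \<le> m" by (simp_all add: sq)
  have h: "norm h \<le> kg * norm e"
    using g_lipschitz[of q qs] by (simp add: h_def q_def)
  have wj: "w \<bullet> (kt *\<^sub>R j) \<le> b + kt\<^sup>2 * m / 4" and ej: "e \<bullet> (kt *\<^sub>R j) \<le> a + kt\<^sup>2 * m / 4"
    using abs_inner_le_weighted_squares[of 1 w "kt *\<^sub>R j"] abs_inner_le_weighted_squares[of 1 e "kt *\<^sub>R j"]
    by (simp_all add: sq power_mult_distrib)
  have wDw: "w \<bullet> (D q *v w) \<le> dM * b"
    unfolding sq by (rule D_quadratic_bound)
  have wC: "\<bar>w \<bullet> (C q w *v y)\<bar> \<le> kc * r * b" if "norm y \<le> r" for y r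
  proof -
    have "\<bar>w \<bullet> (C q w *v y)\<bar> \<le> norm w * norm (C q w *v y)" by (rule Cauchy_Schwarz_ineq2)
    also have "\<dots> \<le> norm w * (kc * norm w * r)"
      using consts_pos that by (intro mult_left_mono order_trans[OF C_bound]) auto
    finally show ?thesis by (simp add: sq power2_eq_square ac_simps)
  qed
  have wCe: "w \<bullet> (C q w *v e) \<le> 2 * (kc * \<Delta>) * b"
    using wC[OF e] by (simp add: ac_simps)
  have wCz: "- \<gamma> * (w \<bullet> (C q w *v z)) \<le> kc * \<Delta> * b / 4"
  proof -
    have "\<gamma> * (- (w \<bullet> (C q w *v z))) \<le> \<gamma> * (kc * (4 * K * \<Delta>) * b)"
      using wC[OF z] \<gamma>_bounds by (intro mult_left_mono) auto
    also have "\<dots> = (\<gamma> * K) * (4 * kc * \<Delta> * b)" by simp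
    finally show ?thesis unfolding \<gamma>_bounds by (simp add: ac_simps)
  qed
  have eh: "- (e \<bullet> h) \<le> kg * a"
  proof -
    have "- (e \<bullet> h) \<le> norm e * norm h" using Cauchy_Schwarz_ineq2[of e h] by linarith
    also have "\<dots> \<le> norm e * (kg * norm e)" by (intro mult_left_mono h) simp
    finally show ?thesis by (simp add: sq power2_eq_square ac_simps)
  qed
  have eDw: "\<gamma> * (e \<bullet> (D q *v w)) \<le> a / 8 + b / 8"
  proof -
    have "e \<bullet> (D q *v w) \<le> dM * (a + b)"
      using D_weighted_cauchy_schwarz[of 1 e q w] D_quadratic_bound[of e q] D_quadratic_bound[of w q]
        D_nonneg[of e q] D_nonneg[of w q] by (simp add: sq distrib_left abs_le_iff)
    then have "\<gamma> * (e \<bullet> (D q *v w)) \<le> \<gamma> * (dM * (a + b))"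
      using \<gamma>_bounds by (intro mult_left_mono) auto
    also have "\<dots> = (\<gamma> * dM) * (a + b)" by simp
    also have "\<dots> \<le> 1 / 16 * (a + b)"
      using \<gamma>_bounds nonneg by (intro mult_right_mono) auto
    finally show ?thesis using nonneg by simp
  qed
  \<comment> \<open>The weight \<open>1 / (8 * K)\<close> makes the share of \<open>z\<close> equal
    to \<open>\<gamma> / 8\<close>. Each of the four products \<open>z \<bullet> e\<close>,
    \<open>z \<bullet> w\<close>, \<open>z \<bullet> h\<close> and \<open>z \<bullet> j\<close> is
    charged this share, together half of \<open>\<gamma> * d\<close>.\<close>
  have cross: "(z \<bullet> y) / 16 \<le> \<gamma> / 8 * d + K / 8 * (norm y)\<^sup>2" for y
  proof -
    have "0 < 1 / (8 * K)" using K_bounds by simp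
    from abs_inner_le_weighted_squares[OF this, of z y]
    have "z \<bullet> y \<le> (1 / (8 * K)) * d + (norm y)\<^sup>2 / (4 * (1 / (8 * K)))"
      unfolding sq abs_le_iff by blast
    then show ?thesis by (simp add: \<gamma>_def ac_simps)
  qed
  have zh: "\<gamma> * (z \<bullet> h) \<le> \<gamma> / 8 * d + kg / 8 * a"
  proof -
    have "(norm h)\<^sup>2 \<le> (kg * norm e)\<^sup>2" by (intro power_mono h) simp
    then have "z \<bullet> h \<le> 1 / 8 * d + 2 * (kg * (kg * a))"
      using abs_inner_le_weighted_squares[of "1 / 8" z h]
      by (simp add: sq abs_le_iff power_mult_distrib power2_eq_square[of kg] mult.assoc)
    then have "\<gamma> * (z \<bullet> h) \<le> \<gamma> * (1 / 8 * d + 2 * (kg * (kg * a)))"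
      using \<gamma>_bounds by (intro mult_left_mono) auto
    also have "\<dots> = \<gamma> / 8 * d + (\<gamma> * kg) * (2 * kg * a)" by (simp add: algebra_simps)
    also have "\<dots> \<le> \<gamma> / 8 * d + 1 / 16 * (2 * kg * a)"
      using \<gamma>_bounds nonneg consts_pos by (intro add_left_mono mult_right_mono) auto
    finally show ?thesis by (simp add: ac_simps)
  qed
  have zj: "- \<gamma> * (z \<bullet> (kt *\<^sub>R j)) \<le> \<gamma> / 8 * d + kt\<^sup>2 * m / 8"
  proof -
    have "- (z \<bullet> (kt *\<^sub>R j)) \<le> 1 / 8 * d + 2 * (kt\<^sup>2 * m)"
      using abs_inner_le_weighted_squares[of "1 / 8" z "kt *\<^sub>R j"]
      by (simp add: sq abs_le_iff power_mult_distrib)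
    then have "\<gamma> * - (z \<bullet> (kt *\<^sub>R j)) \<le> \<gamma> * (1 / 8 * d + 2 * (kt\<^sup>2 * m))"
      using \<gamma>_bounds by (intro mult_left_mono) auto
    also have "\<dots> = \<gamma> / 8 * d + \<gamma> * (2 * (kt\<^sup>2 * m))" by (simp add: algebra_simps)
    also have "\<dots> \<le> \<gamma> / 8 * d + 1 / 16 * (2 * (kt\<^sup>2 * m))"
      using \<gamma>_bounds nonneg by (intro add_left_mono mult_right_mono) auto
    finally show ?thesis by (simp add: ac_simps)
  qed
  have ze: "(z \<bullet> e) / 16 \<le> \<gamma> / 8 * d + K / 8 * a" and zw: "(z \<bullet> w) / 16 \<le> \<gamma> / 8 * d + K / 8 * b"
    using cross unfolding sq by blast+
  have Ka: "10 * a + 8 * (kg * a) \<le> K * a" and Kb: "10 * b + 8 * (dM * b) + 8 * (kc * \<Delta> * b) \<le> K * b"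
  proof -
    have "(10 + 8 * kg) * a \<le> K * a" "(10 + 8 * dM + 8 * (kc * \<Delta>)) * b \<le> K * b"
      using K_large consts_pos kc\<Delta>_pos M_pos nonneg by (intro mult_right_mono; linarith)+
    then show "10 * a + 8 * (kg * a) \<le> K * a" "10 * b + 8 * (dM * b) + 8 * (kc * \<Delta> * b) \<le> K * b"
      by (simp_all add: algebra_simps)
  qed
  have cM: "kt\<^sup>2 * m + m \<le> c * M * m"
    using mult_right_mono[OF M_large nonneg(4)] by (simp add: algebra_simps)
  have pos: "0 \<le> kg * a" "0 \<le> dM * b" "0 \<le> kc * \<Delta> * b" "0 \<le> kt\<^sup>2 * m"
    using nonneg consts_pos kc\<Delta>_pos by simp_all
  have "V' (e, w, z, j) = - (K * b) + w \<bullet> (kt *\<^sub>R j) + a + w \<bullet> (D q *v w) + w \<bullet> (C q w *v e)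
     - K * a - e \<bullet> h + e \<bullet> (kt *\<^sub>R j)
     + \<gamma> * (e \<bullet> (D q *v w)) - \<gamma> * (w \<bullet> (C q w *v z)) + (z \<bullet> e) / 16 + (z \<bullet> w) / 16
     - \<gamma> * d + \<gamma> * (z \<bullet> h) - \<gamma> * (z \<bullet> (kt *\<^sub>R j)) - c * M * m"
    by (simp add: V'_def Let_def sq power2_norm_eq_inner q_def h_def)
  \<comment> \<open>Besides the shares \<open>K / 8\<close> taken by \<open>ze\<close> and
    \<open>zw\<close>, the terms in \<open>a\<close> and \<open>b\<close> are covered by 3/8 of
    \<open>Ka\<close> and \<open>Kb\<close>. The perturbation costs 5/8 of
    \<open>kt\<^sup>2 * m\<close>, which \<open>cM\<close> covers with \<open>m\<close> to
    spare.\<close>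
  also have "\<dots> \<le> - (K * a / 2) - K * b / 2 - \<gamma> / 2 * d - m"
    using wj ej wDw wCe wCz eh eDw zh zj ze zw Ka Kb cM pos nonneg by linarith
  also have "\<dots> \<le> - (1 / (32 * K)) * (a + b + d + m)"
  proof -
    have eq: "1 / (32 * K) = \<gamma> / 2" by (simp add: \<gamma>_def)
    \<comment> \<open>The rate in \<open>z\<close> is the slowest of the four and becomes the common
      one.\<close>
    have "\<gamma> / 2 * a \<le> K / 2 * a" "\<gamma> / 2 * b \<le> K / 2 * b" "\<gamma> / 2 * m \<le> 1 * m"
      using nonneg \<gamma>_bounds K_bounds by (intro mult_right_mono; simp)+
    then show ?thesis unfolding eq by (simp add: algebra_simps add_divide_distrib)
  qed
  finally show ?thesis by (simp add: norm_quadruple sq)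
qed

section \<open>The trapping region\<close>

text \<open>Bounds exactly the two components whose size enters \<open>V'_decay\<close>.\<close>

definition region :: "((real^'n) \<times> (real^'n) \<times> (real^'n) \<times> (real^'n)) set" where
  "region = {(e, w, z, j). norm e \<le> 2 * \<Delta> \<and> norm z \<le> 4 * K * \<Delta>}"

lemma closed_region: "closed region"
  unfolding region_def case_prod_beta by (intro closed_Collect_conj closed_Collect_le continuous_intros)

lemma V_nonneg: "0 \<le> V x"
proof -
  obtain e w z j where x: "x = (e, w, z, j)" by (metis prod_cases4)
  show ?thesis
    using K_bounds M_pos unfolding x by (intro order_trans[OF _ V_bounds(1)] add_nonneg_nonneg) (auto simp: D_nonneg)
qed

text \<open>In the bound for \<open>e\<close> the gain cancels and leaves
  \<open>3 * \<Delta>\<^sup>2\<close>, below \<open>4 * \<Delta>\<^sup>2\<close>. For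
  \<open>z\<close> one gets \<open>12 * (K * \<Delta>\<^sup>2)\<close>, below
  \<open>16 * K\<^sup>2 * \<Delta>\<^sup>2\<close> because \<open>K\<close> exceeds 1; the strict
  inequalities give an open neighbourhood.\<close>

lemma sublevel_subset_interior_region:
  assumes "V y \<le> 3 * K / 2 * \<Delta>\<^sup>2"
  shows "y \<in> interior region"
proof -
  obtain e w z j where y: "y = (e, w, z, j)" by (metis prod_cases4)
  have "w \<bullet> (D (qs + e) *v w) / 4 + K / 2 * (norm e)\<^sup>2 + (norm z)\<^sup>2 / 8 + M / 2 * (norm j)\<^sup>2 \<le> 3 * K / 2 * \<Delta>\<^sup>2"
    using V_bounds(1)[of w e z j] assms unfolding y by linarith
  moreover have "0 \<le> w \<bullet> (D (qs + e) *v w)" "0 \<le> K * (norm e)\<^sup>2" "0 \<le> (norm z)\<^sup>2" "0 \<le> M * (norm j)\<^sup>2"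
    using D_nonneg K_bounds M_pos by simp_all
  ultimately have "K * (norm e)\<^sup>2 \<le> K * (3 * \<Delta>\<^sup>2)" and z: "(norm z)\<^sup>2 \<le> 12 * (K * \<Delta>\<^sup>2)"
    by linarith+
  then have "(norm e)\<^sup>2 \<le> 3 * \<Delta>\<^sup>2" using K_bounds by simp
  also have "\<dots> < (2 * \<Delta>)\<^sup>2" using \<Delta>_pos by (simp add: power_mult_distrib)
  finally have e: "norm e < 2 * \<Delta>"
    by (rule power2_less_imp_less) (use \<Delta>_pos in simp)
  note z
  also have "12 * (K * \<Delta>\<^sup>2) < (4 * K * \<Delta>)\<^sup>2"
    using \<Delta>_pos K_bounds by (simp add: power_mult_distrib power2_eq_square[of K])
  finally have z: "norm z < 4 * K * \<Delta>"
    by (rule power2_less_imp_less) (use \<Delta>_pos K_bounds in simp)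
  have "open {y :: (real^'n) \<times> (real^'n) \<times> (real^'n) \<times> (real^'n).
      norm (fst y) < 2 * \<Delta> \<and> norm (fst (snd (snd y))) < 4 * K * \<Delta>}" (is "open ?O")
    by (intro open_Collect_conj open_Collect_less continuous_intros)
  moreover have "?O \<subseteq> region" by (auto simp: region_def)
  moreover have "y \<in> ?O" using e z by (simp add: y)
  ultimately show ?thesis by (meson interior_maximal subsetD)
qed

section \<open>Local Lipschitz continuity of the closed loop\<close>

text \<open>The inverse inertia matrix is never differentiated: the acceleration solves
  \<open>D (q x) *v acc x = net_force x\<close>, and local coercivity of \<open>D\<close> transfers
  Lipschitz continuity from the force to the solution of this linear equation.\<close>

lemma field_lipschitz: "\<exists>L. L-lipschitz_on (cball 0 r) field"
proof (cases "r < 0")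
  case False
  define S where "S = cball (0 :: (real^'n) \<times> (real^'n) \<times> (real^'n) \<times> (real^'n)) r"
  define q where "q x = qs + fst x" for x :: "(real^'n) \<times> (real^'n) \<times> (real^'n) \<times> (real^'n)"
  have "bounded S" by (simp add: S_def)
  have fst: "1-lipschitz_on A fst" for A :: "('a::metric_space \<times> 'b::metric_space) set"
    by (intro lipschitz_onI) (simp_all add: dist_fst_le)
  have snd: "1-lipschitz_on A snd" for A :: "('a::metric_space \<times> 'b::metric_space) set"
    by (intro lipschitz_onI) (simp_all add: dist_snd_le)
  have e: "1-lipschitz_on S fst" by (rule fst)
  have w: "1-lipschitz_on S (\<lambda>x. fst (snd x))"
    using lipschitz_on_compose2[OF snd fst] by simp
  have zj: "1-lipschitz_on S (\<lambda>x. snd (snd x))"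
    using lipschitz_on_compose2[OF snd snd] by simp
  have z: "1-lipschitz_on S (\<lambda>x. fst (snd (snd x)))" and j: "1-lipschitz_on S (\<lambda>x. snd (snd (snd x)))"
    using lipschitz_on_compose2[OF zj fst] lipschitz_on_compose2[OF zj snd] by simp_all
  have q: "(0 + 1)-lipschitz_on S q"
    unfolding q_def by (intro lipschitz_on_add lipschitz_on_constant e)
  have q_in: "q x \<in> cball qs r" if "x \<in> S" for x
    using that norm_fst_le[of "fst x" "snd x"] by (simp add: S_def q_def dist_norm)
  obtain Lg where Lg: "Lg-lipschitz_on (cball qs r) g"
    using twice_cont_diff_lipschitz_on_cball[OF g_smooth] .
  obtain LD where LD: "LD-lipschitz_on (cball qs r) D"
    using twice_cont_diff_lipschitz_on_cball[OF D_smooth] .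
  obtain LC where LC: "LC-lipschitz_on (cball (qs, 0) r) (\<lambda>(q, w). C q w)"
    using twice_cont_diff_lipschitz_on_cball[OF C_smooth] .
  have gq: "(Lg * (0 + 1))-lipschitz_on S (\<lambda>x. g (q x))"
    using q_in by (intro lipschitz_on_compose2[OF q] lipschitz_on_subset[OF Lg]) auto
  have Dq: "(LD * (0 + 1))-lipschitz_on S (\<lambda>x. D (q x))"
    using q_in by (intro lipschitz_on_compose2[OF q] lipschitz_on_subset[OF LD]) auto
  have "(q x, fst (snd x)) \<in> cball (qs, 0) r" if "x \<in> S" for x
  proof -
    obtain e w z j where x: "x = (e, w, z, j)" by (metis prod_cases4)
    have "(norm (e, w))\<^sup>2 \<le> (norm x)\<^sup>2"
      unfolding x norm_quadruple by (simp add: norm_Pair)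
    then have "norm (e, w) \<le> norm x" by (rule power2_le_imp_le) simp
    moreover have "dist (qs, 0) (q x, fst (snd x)) = norm (e, w)"
      by (simp add: x q_def dist_norm norm_Pair)
    ultimately show ?thesis using that by (simp add: S_def)
  qed
  then have "(LC * sqrt ((0 + 1)\<^sup>2 + 1\<^sup>2))-lipschitz_on S (\<lambda>x. case (q x, fst (snd x)) of (q, w) \<Rightarrow> C q w)"
    by (intro lipschitz_on_compose2[OF lipschitz_on_Pair[OF q w]] lipschitz_on_subset[OF LC]) auto
  then obtain LCw where Cw: "LCw-lipschitz_on S (\<lambda>x. C (q x) (fst (snd x)) *v fst (snd x))"
    using lipschitz_on_bounded_bilinear[OF bounded_bilinear_matrix_vector_mult _ w \<open>bounded S\<close>]
    by (auto simp only: prod.case)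
  have "\<exists>L. L-lipschitz_on S (\<lambda>x. - (K *\<^sub>R fst x) - K *\<^sub>R fst (snd x) + fst (snd (snd x))
      - (g (q x) - g qs) + kt *\<^sub>R snd (snd (snd x)) - C (q x) (fst (snd x)) *v fst (snd x))"
    by (rule exI, rule lipschitz_on_diff[OF lipschitz_on_add[OF lipschitz_on_diff[OF lipschitz_on_add[OF
        lipschitz_on_diff[OF lipschitz_on_minus[OF lipschitz_on_cmult[OF e]] lipschitz_on_cmult[OF w]]
        z] lipschitz_on_diff[OF gq lipschitz_on_constant]] lipschitz_on_cmult[OF j]] Cw])
  moreover have "(\<lambda>x. - (K *\<^sub>R fst x) - K *\<^sub>R fst (snd x) + fst (snd (snd x))
      - (g (q x) - g qs) + kt *\<^sub>R snd (snd (snd x)) - C (q x) (fst (snd x)) *v fst (snd x)) = net_force"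
    by (simp add: net_force_def q_def fun_eq_iff split: prod.split)
  ultimately have "\<exists>L. L-lipschitz_on S net_force" by (simp only:)
  then obtain LF where F: "LF-lipschitz_on S net_force" by blast
  define acc where "acc x = matrix_inv (D (q x)) *v net_force x" for x
  have D_acc: "D (q x) *v acc x = net_force x" for x
    unfolding acc_def using positive_definite_inverse[OF D_pos[of "q x"]]
    by (simp add: matrix_vector_mul_assoc)
  obtain l where l: "0 < l" "\<And>p v. p \<in> cball qs r \<Longrightarrow> l * (norm v)\<^sup>2 \<le> v \<bullet> (D p *v v)"
    using D_coercive_on_cball[of r qs] False by auto
  have l_norm: "l * norm v \<le> norm (D (q x) *v v)" if "x \<in> S" for x v
  proof (cases "v = 0")
    case False
    have "(l * norm v) * norm v \<le> norm (D (q x) *v v) * norm v"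
      using l(2)[OF q_in[OF that], of v] norm_cauchy_schwarz[of v "D (q x) *v v"]
      by (simp add: power2_eq_square ac_simps)
    then show ?thesis using False by simp
  qed simp
  obtain A where A: "0 < A" "\<And>x. x \<in> S \<Longrightarrow> norm (acc x) \<le> A"
  proof -
    have "bounded (net_force ` S)"
      using lipschitz_on_uniformly_continuous[OF F] \<open>bounded S\<close> by (rule bounded_uniformly_continuous_image)
    then obtain B where B: "0 < B" "\<And>x. x \<in> S \<Longrightarrow> norm (net_force x) \<le> B"
      unfolding bounded_pos by blast
    show ?thesis
    proof (rule that)
      show "0 < B / l" using B l by simp
      show "norm (acc x) \<le> B / l" if "x \<in> S" for x
        using l_norm[OF that, of "acc x"] B(2)[OF that] l(1)
        by (simp add: D_acc pos_le_divide_eq mult.commute)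
    qed
  qed
  obtain H where H: "0 \<le> H" "\<And>(X :: real^'n^'n) v. norm (X *v v) \<le> norm X * norm v * H"
    using bounded_bilinear.nonneg_bounded[OF bounded_bilinear_matrix_vector_mult] by blast
  note nonneg = lipschitz_on_nonneg[OF F] lipschitz_on_nonneg[OF Dq]
  have acc: "((LF + LD * (0 + 1) * A * H) / l)-lipschitz_on S acc"
  proof (rule lipschitz_onI)
    fix x y assume x: "x \<in> S" and y: "y \<in> S"
    have "l * norm (acc x - acc y) \<le> norm (D (q x) *v (acc x - acc y))" by (rule l_norm[OF x])
    \<comment> \<open>Subtracting the equations at \<open>x\<close> and \<open>y\<close> leaves the
      change of the force and the change of \<open>D\<close> applied to the bounded
      \<open>acc y\<close>.\<close>
    also have "D (q x) *v (acc x - acc y) = (net_force x - net_force y) - (D (q x) - D (q y)) *v acc y"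
      by (simp add: matrix_vector_mult_diff_distrib matrix_vector_mult_diff_rdistrib D_acc)
    also have "norm \<dots> \<le> norm (net_force x - net_force y) + norm (D (q x) - D (q y)) * norm (acc y) * H"
      by (rule order_trans[OF norm_triangle_ineq4]) (intro add_left_mono H)
    also have "\<dots> \<le> LF * dist x y + (LD * (0 + 1) * dist x y) * A * H"
      using lipschitz_onD[OF F x y] lipschitz_onD[OF Dq x y] A H nonneg y
      by (intro add_mono mult_right_mono[OF mult_mono]) (auto simp: dist_norm)
    finally show "dist (acc x) (acc y) \<le> (LF + LD * (0 + 1) * A * H) / l * dist x y"
      using l(1) by (simp add: dist_norm field_simps)
  qed (use nonneg A H l in simp)
  have "\<exists>L. L-lipschitz_on S (\<lambda>x. (fst (snd x), acc x, - fst x, - (c *\<^sub>R snd (snd (snd x)))))"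
    by (rule exI, rule lipschitz_on_Pair[OF w lipschitz_on_Pair[OF acc lipschitz_on_Pair[OF
        lipschitz_on_minus[OF e] lipschitz_on_minus[OF lipschitz_on_cmult[OF j]]]]])
  moreover have "(\<lambda>x. (fst (snd x), acc x, - fst x, - (c *\<^sub>R snd (snd (snd x))))) = field"
    by (simp add: field_def acc_def q_def fun_eq_iff split: prod.split)
  ultimately show ?thesis unfolding S_def by (simp only:)
qed (auto simp: lipschitz_on_def intro: exI[of _ 0])

section \<open>Exponential decay for the chosen gain\<close>

lemma field_exp_decay:
  obtains \<kappa> \<alpha> where "0 < \<kappa>" "0 < \<alpha>"
    "\<And>x t0 T t. ode_solution (\<lambda>t. field) {t0..<T} x \<Longrightarrow> norm (x t0) \<le> \<Delta> \<Longrightarrow> t \<in> {t0..<T} \<Longrightarrow>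
      norm (x t) \<le> \<kappa> * norm (x t0) * exp (- \<alpha> * (t - t0))"
proof -
  \<comment> \<open>The dissipation coefficient \<open>1 / (32 * K)\<close> divided by the upper
    coefficient \<open>3 * K / 2\<close> of \<open>V\<close>.\<close>
  define \<mu> where "\<mu> = 1 / (48 * K\<^sup>2)"
  have "0 < \<mu>" using K_bounds by (simp add: \<mu>_def)
  obtain l where l: "0 < l" "\<And>q v. q \<in> cball qs (2 * \<Delta>) \<Longrightarrow> l * (norm v)\<^sup>2 \<le> v \<bullet> (D q *v v)"
    using D_coercive_on_cball[of "2 * \<Delta>" qs] \<Delta>_pos by auto
  \<comment> \<open>The least coefficient in the lower bound of \<open>V\<close>, with
    \<open>l\<close> the coercivity constant of \<open>D\<close> on the ball to which the region
    confines \<open>qs + e\<close>; \<open>K / 2\<close> exceeds 1/8.\<close>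
  define b where "b = min (l / 4) (min (1 / 8) (M / 2))"
  have "0 < b" using l M_pos by (simp add: b_def)
  have V_ge: "b * (norm y)\<^sup>2 \<le> V y" if "y \<in> region" for y
  proof -
    obtain e w z j where y: "y = (e, w, z, j)" by (metis prod_cases4)
    have "qs + e \<in> cball qs (2 * \<Delta>)" using that by (simp add: y region_def dist_norm)
    from l(2)[OF this] have "l / 4 * (norm w)\<^sup>2 \<le> w \<bullet> (D (qs + e) *v w) / 4" by simp
    moreover have "b * (norm w)\<^sup>2 \<le> l / 4 * (norm w)\<^sup>2" "b * (norm e)\<^sup>2 \<le> K / 2 * (norm e)\<^sup>2"
      "b * (norm z)\<^sup>2 \<le> 1 / 8 * (norm z)\<^sup>2" "b * (norm j)\<^sup>2 \<le> M / 2 * (norm j)\<^sup>2"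
      using K_bounds by (intro mult_right_mono; simp add: b_def)+
    ultimately show ?thesis
      using V_bounds(1)[of w e z j] unfolding y norm_quadruple distrib_left by linarith
  qed
  have V'_le: "V' y \<le> - \<mu> * V y" if "y \<in> region" for y
  proof -
    have "\<mu> * V y \<le> \<mu> * (3 * K / 2 * (norm y)\<^sup>2)"
      using \<open>0 < \<mu>\<close> V_le by (intro mult_left_mono) auto
    also have "\<dots> = 1 / (32 * K) * (norm y)\<^sup>2"
      using K_bounds by (simp add: \<mu>_def power2_eq_square)
    finally have "\<mu> * V y \<le> 1 / (32 * K) * (norm y)\<^sup>2" .
    moreover have "V' y \<le> - (1 / (32 * K)) * (norm y)\<^sup>2"
      using that unfolding region_def by (cases y) (clarify, rule V'_decay)
    ultimately show ?thesis by linarith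
  qed
  \<comment> \<open>Square root of the ratio of the quadratic bounds on \<open>V\<close>; passing
    from \<open>V\<close> to the norm also halves the rate.\<close>
  define \<kappa> where "\<kappa> = sqrt (3 * K / 2 / b)"
  show ?thesis
  proof (rule that)
    show "0 < \<kappa>" using K_bounds \<open>0 < b\<close> by (simp add: \<kappa>_def)
    show "0 < \<mu> / 2" using \<open>0 < \<mu>\<close> by simp
    fix x t0 T t
    assume sol: "ode_solution (\<lambda>t. field) {t0..<T} x" and x0: "norm (x t0) \<le> \<Delta>" and t: "t \<in> {t0..<T}"
    have "V (x t0) \<le> 3 * K / 2 * (norm (x t0))\<^sup>2" by (rule V_le)
    also have "\<dots> \<le> 3 * K / 2 * \<Delta>\<^sup>2"
      using x0 K_bounds by (intro mult_left_mono power_mono) auto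
    finally have V0: "V (x t0) \<le> 3 * K / 2 * \<Delta>\<^sup>2" .
    have "x t \<in> region \<and> V (x t) \<le> V (x t0) * exp (- \<mu> * (t - t0))"
    proof (rule lyapunov_trapping)
      show "continuous_on {t0..<T} x"
        using sol unfolding ode_solution_def by (intro continuous_on_vector_derivative) blast
      show "((\<lambda>t. V (x t)) has_real_derivative V' (x t)) (at t within {t0..<T})" if "t \<in> {t0..<T}" for t
        using sol that by (rule V_has_derivative)
      show "y \<in> interior region" if "V y \<le> V (x t0)" for y
        using that V0 by (intro sublevel_subset_interior_region) simp
      show "x t0 \<in> region"
        using sublevel_subset_interior_region[OF V0] interior_subset by blast
    qed (use t \<open>0 < \<mu>\<close> closed_region V_nonneg V'_le in auto)
    then have "b * (norm (x t))\<^sup>2 \<le> V (x t0) * exp (- \<mu> * (t - t0))"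
      using V_ge[of "x t"] by linarith
    also have "\<dots> \<le> (3 * K / 2 * (norm (x t0))\<^sup>2) * exp (- \<mu> * (t - t0))"
      by (intro mult_right_mono V_le) simp
    also have "exp (- \<mu> * (t - t0)) = (exp (- (\<mu> / 2) * (t - t0)))\<^sup>2"
      by (simp flip: exp_double)
    finally have "(norm (x t))\<^sup>2 \<le> 3 * K / 2 / b * (norm (x t0))\<^sup>2 * (exp (- (\<mu> / 2) * (t - t0)))\<^sup>2"
      using \<open>0 < b\<close> by (simp add: field_simps)
    also have "\<dots> = (\<kappa> * norm (x t0) * exp (- (\<mu> / 2) * (t - t0)))\<^sup>2"
      using K_bounds \<open>0 < b\<close> by (simp add: \<kappa>_def power_mult_distrib)
    finally show "norm (x t) \<le> \<kappa> * norm (x t0) * exp (- (\<mu> / 2) * (t - t0))"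
      by (rule power2_le_imp_le) (use \<open>0 < \<kappa>\<close> in simp)
  qed
qed

lemma UAS_on_field: "UAS_on (\<lambda>t. field) (cball 0 \<Delta>)"
proof -
  obtain \<kappa> \<alpha> where "0 < \<kappa>" "0 < \<alpha>"
    and decay: "\<And>x t0 T t. ode_solution (\<lambda>t. field) {t0..<T} x \<Longrightarrow> norm (x t0) \<le> \<Delta> \<Longrightarrow> t \<in> {t0..<T} \<Longrightarrow>
      norm (x t) \<le> \<kappa> * norm (x t0) * exp (- \<alpha> * (t - t0))"
    using field_exp_decay by blast
  then show ?thesis
    using UAS_on_cball_of_exp_decay[OF field_lipschitz _ \<Delta>_pos, of \<kappa> \<alpha>] by blast
qed

end

section \<open>Choice of the gains and reduction of the closed loop\<close>

theorem proposition4: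
  fixes D :: "real^'n \<Rightarrow> real^'n^'n"
    and C :: "real^'n \<Rightarrow> real^'n \<Rightarrow> real^'n^'n"
    and g :: "real^'n \<Rightarrow> real^'n"
    and U :: "real^'n \<Rightarrow> real"
    and qs :: "real^'n"
    and L R kb kt R' dm dM kc kg :: real
  assumes "L > 0" and "R > 0" and "kb > 0" and "kt > 0" and "R' > 0"
    and "\<And>q. transpose (D q) = D q"
    and "\<And>q. positive_definite (D q)"
    and "\<And>q w. transpose (frechet_derivative D (at q) w - 2 *\<^sub>R C q w)
                  = - (frechet_derivative D (at q) w - 2 *\<^sub>R C q w)"
    and "\<And>q. (U has_derivative (\<lambda>h. g q \<bullet> h)) (at q)"
    and "twice_cont_diff D"
    and "twice_cont_diff (\<lambda>(q, w). C q w)"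
    and "twice_cont_diff g"
    and "\<And>a b. partials_overbounded (\<lambda>(q, w). D q $ a $ b)"
    and "\<And>a b. partials_overbounded (\<lambda>(q, w). C q w $ a $ b)"
    and "\<And>a. partials_overbounded (\<lambda>(q, w). g q $ a)"
    and "dm > 0" and "dM > 0" and "kc > 0" and "kg > 0"
    and "\<And>q. dm \<le> matrix_norm (D q)"
    and "\<And>q. matrix_norm (D q) \<le> dM"
    and "\<And>q w. matrix_norm (C q w) \<le> kc * norm w"
    and "\<And>q. onorm (frechet_derivative g (at q)) \<le> kg"
  shows "USAS (closed_loop D C g L R kb kt R' qs) ({0<..} \<times> {0<..} \<times> {0<..})"
  unfolding USAS_def
proof (intro allI impI)
  fix \<Delta> :: real assume "0 < \<Delta>"
  \<comment> \<open>With \<open>v\<close> inserted, the feedforward terms cancel and leave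
    \<open>L j' = - (R + R') j\<close>.\<close>
  define c where "c = (R + R') / L"
  have "0 < c" using assms(1-5) by (simp add: c_def)
  \<comment> \<open>Makes \<open>M_large\<close> an equality; it depends on neither \<Delta> nor the
    gains, so \<open>K\<close> can be defined from it next.\<close>
  define M where "M = (kt\<^sup>2 + 1) / c"
  define K where "K = 10 + 8 * kg + 8 * dM + 8 * (kc * \<Delta>) + M"
  have "0 < M" using \<open>0 < c\<close> by (simp add: M_def add_nonneg_pos)
  interpret pid_loop D C g U qs dM kc kg kt c \<Delta> M K
    by unfold_locales (use assms \<open>0 < c\<close> \<open>0 < M\<close> \<open>0 < \<Delta>\<close> in \<open>simp_all add: M_def K_def\<close>)
  have "closed_loop D C g L R kb kt R' qs t x (K, K, 1) = field x" for t x
  proof -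
    obtain e w z j where x: "x = (e, w, z, j)" by (metis prod_cases4)
    define u where "u = - (K *\<^sub>R e) - K *\<^sub>R w + (g qs + z)"
    have u: "kt *\<^sub>R ((1 / kt) *\<^sub>R u + j) - C (qs + e) w *v w - g (qs + e) = net_force x"
      using \<open>kt > 0\<close> by (simp add: x net_force_def u_def scaleR_add_right)
    have dj: "(1 / L) *\<^sub>R (- (R' *\<^sub>R j) + R *\<^sub>R i + kb *\<^sub>R w + L *\<^sub>R d - R *\<^sub>R (i + j) - kb *\<^sub>R w) - d
        = - (c *\<^sub>R j)" for i d
      using \<open>L > 0\<close> by (simp add: c_def algebra_simps add_divide_distrib)
    show ?thesis
      unfolding x closed_loop_def field_def Let_def prod.case u_def[symmetric] u[unfolded x] dj scaleR_one ..
  qed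
  then have "UAS_on (\<lambda>t x. closed_loop D C g L R kb kt R' qs t x (K, K, 1)) (cball 0 \<Delta>)"
    using UAS_on_field by simp
  moreover have "(K, K, 1 :: real) \<in> {0<..} \<times> {0<..} \<times> {0<..}" using K_bounds by simp
  ultimately show "\<exists>\<theta>\<in>{0<..} \<times> {0<..} \<times> {0<..}.
      UAS_on (\<lambda>t x. closed_loop D C g L R kb kt R' qs t x \<theta>) (cball 0 \<Delta>)"
    by blast
qed

end
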